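(* Let $N\ge2$, let $A\subset\mathbb{R}^N$ be open, and let $\kappa\colon[0,\infty)\to\mathbb{R}$ be a $C^1$ function satisfying ($\kappa1$) $\lim_{r\to\infty}\kappa(r)=0$ and $\int_{\mathbb{R}^N}|\kappa(\|x\|^2)|\,dx<\infty$; ($\kappa2$) $\lim_{r\to\infty}r\kappa'(r^2)=0$ and $\int_{\mathbb{R}^N}\sup_{b\in K}\big(\|x+b\|\,|\kappa'(\|x+b\|^2)|\big)\,dx<\infty$ for every compact $K\subset\mathbb{R}^N$. For $t>0$, $x\in\mathbb{R}^N$ put $h(t,x)=\int_{A}t^{-N/2}\kappa(\|x-y\|^2/t)\,dy$. Let $\alpha\in(0,1]$ and assume that $\partial A$ is a $C^{1,\alpha}$-surface at $p\in\partial A$. Let $n$ be the unit normal vector field of $\partial A$ near $p$ oriented outwards from $A$. Then $$\nabla_x h(t,x)=-t^{-\frac12}\,n(x)\,(\xi+o(1))\quad\text{as }t\to0^+$$ uniformly on $\partial A\cap U$ for some neighborhood $U\subseteq\mathbb{R}^N$ of $p$, where $\xi$ is the scalar $$\xi=S_{N-2}\int_0^\infty\kappa(r^2)r^{N-2}\,dr$$ and $S_{N-2}$ is the area of the unit sphere in $\mathbb{R}^{N-1}$ (with the interpretation $S_0=2$).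
   Context: $\partial A$ is called a $C^{1,\alpha}$-surface at $p\in\partial A$ if there are an open neighborhood $U\subseteq\mathbb{R}^N$ of $p$ and a $C^{1,\alpha}$-diffeomorphism $\varphi$ of $U$ onto an open neighborhood $\varphi(U)\subseteq\mathbb{R}^N$ of $0$ with $\varphi(p)=0$ and $\varphi(A\cap U)=\{x\in\varphi(U):x_N>0\}$. Equivalently, there are an orthonormal basis $v_1,\dots,v_N$ of $\mathbb{R}^N$, numbers $\delta_1,\dots,\delta_N>0$, $V=\prod_{i=1}^N(-\delta_i,\delta_i)$, $V'=\prod_{i=1}^{N-1}(-\delta_i,\delta_i)$, and a $C^{1,\alpha}$-function $f\colon V'\to(-\delta_N,\delta_N)$ with $f(0)=0$ and $A\cap\{p+\sum_{i=1}^N x_iv_i:x\in V\}=\{p+\sum_{i=1}^N x_iv_i:x'\in V',\ f(x')<x_N<\delta_N\}$, where $x'=(x_1,\dots,x_{N-1})$. Condition ($\kappa2$) ensures that the gradient $\nabla_x h(t,x)$ can be calculated by differentiating under the integral.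
   Formalization: The o(1) in n(x)(ξ+o(1)) is taken as a vector-valued error: the gradient is −t^{-1/2}(ξ n(x)+R(t,x)) with R→0 uniformly, since for asymmetric A the gradient need not be parallel to n(x) and the scalar form fails. *)

theory Defs
  imports "HOL-Analysis.Analysis"
begin

(* C^{1,\<alpha>} on an open set S: the Hoelder condition on the derivative is local. *)
definition C1_Holder_on ::
  "real \<Rightarrow> 'a::real_normed_vector set \<Rightarrow> ('a \<Rightarrow> 'b::real_normed_vector) \<Rightarrow> bool" where
  "C1_Holder_on \<alpha> S f \<longleftrightarrow>
     (\<exists>f'. (\<forall>x\<in>S. (f has_derivative blinfun_apply (f' x)) (at x)) \<and>
           (\<forall>x\<in>S. \<exists>W C. open W \<and> x \<in> W \<and>
              (\<forall>y\<in>S \<inter> W. \<forall>z\<in>S \<inter> W. norm (f' y - f' z) \<le> C * dist y z powr \<alpha>)))"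

definition C1_Holder_diffeomorphism ::
  "real \<Rightarrow> 'a::real_normed_vector set \<Rightarrow> 'b::real_normed_vector set \<Rightarrow> ('a \<Rightarrow> 'b) \<Rightarrow> bool" where
  "C1_Holder_diffeomorphism \<alpha> U V \<phi> \<longleftrightarrow>
     open U \<and> open V \<and>
     (\<exists>\<psi>. homeomorphism U V \<phi> \<psi> \<and> C1_Holder_on \<alpha> U \<phi> \<and> C1_Holder_on \<alpha> V \<psi>)"

(* The index type carries no order, so some coordinate k plays the role of the last one;
   permuting coordinates is a diffeomorphism, so its choice is immaterial. *)
definition C1_Holder_surface_at :: "real \<Rightarrow> (real ^ 'n::finite) set \<Rightarrow> real ^ 'n \<Rightarrow> bool" where
  "C1_Holder_surface_at \<alpha> A p \<longleftrightarrow>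
     (\<exists>U (\<phi> :: real ^ 'n \<Rightarrow> real ^ 'n) k.
        p \<in> U \<and> C1_Holder_diffeomorphism \<alpha> U (\<phi> ` U) \<phi> \<and> \<phi> p = 0 \<and>
        \<phi> ` (A \<inter> U) = {x \<in> \<phi> ` U. x $ k > 0})"

definition tangent_vector_at :: "'a::real_normed_vector set \<Rightarrow> 'a \<Rightarrow> 'a \<Rightarrow> bool" where
  "tangent_vector_at S x v \<longleftrightarrow>
     (\<exists>\<gamma> \<epsilon>. \<epsilon> > 0 \<and> \<gamma> C1_differentiable_on {-\<epsilon><..<\<epsilon>} \<and> \<gamma> ` {-\<epsilon><..<\<epsilon>} \<subseteq> S \<and>
           \<gamma> 0 = x \<and> (\<gamma> has_vector_derivative v) (at (0::real)))"

(* Where the boundary is a C^1 surface bounding A from one side, such \<nu> exists and is unique. *)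
definition outward_unit_normal_at :: "'a::real_inner set \<Rightarrow> 'a \<Rightarrow> 'a \<Rightarrow> bool" where
  "outward_unit_normal_at A x \<nu> \<longleftrightarrow>
     norm \<nu> = 1 \<and>
     (\<forall>v. tangent_vector_at (frontier A) x v \<longrightarrow> \<nu> \<bullet> v = 0) \<and>
     (\<forall>\<^sub>F s in at_right 0. x + s *\<^sub>R \<nu> \<notin> A \<and> x - s *\<^sub>R \<nu> \<in> A)"

definition kernel_integral ::
  "(real ^ 'n::finite) set \<Rightarrow> (real \<Rightarrow> real) \<Rightarrow> real \<Rightarrow> real ^ 'n \<Rightarrow> real" where
  "kernel_integral A \<kappa> t x =
     (LINT y:A|lborel. t powr (- real CARD('n) / 2) * \<kappa> ((norm (x - y))\<^sup>2 / t))"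

(* Area of the unit sphere in m-dimensional Euclidean space, i.e. the total mass of the surface
   measure E |-> m * vol {r x | x \<in> E, 0 < r \<le> 1} of polar coordinates. The lemmas
   below identify it with the derivative of the ball volume and give the closed form. *)
definition unit_sphere_area :: "nat \<Rightarrow> real" where
  "unit_sphere_area m = real m * unit_ball_vol (real m)"

lemma unit_sphere_area_1: "unit_sphere_area 1 = 2"
  by (simp add: unit_sphere_area_def)

lemma unit_sphere_area_closed_form:
  assumes "m > 0"
  shows "unit_sphere_area m = 2 * pi powr (real m / 2) / Gamma (real m / 2)"
proof -
  have "Gamma (real m / 2 + 1) = real m / 2 * Gamma (real m / 2)"
    using assms by (intro Gamma_plus1) (auto simp: nonpos_Ints_def)
  moreover have "Gamma (real m / 2) > 0"
    using assms by (intro Gamma_real_pos) simp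
  ultimately show ?thesis
    using assms by (simp only: unit_sphere_area_def unit_ball_vol_def) (simp add: divide_simps)
qed

lemma has_real_derivative_content_ball:
  "((\<lambda>r. measure lborel (ball (c::'a::euclidean_space) r)) has_real_derivative
     unit_sphere_area DIM('a)) (at 1)"
proof -
  have "((\<lambda>r. unit_ball_vol (real DIM('a)) * r ^ DIM('a)) has_real_derivative
          unit_sphere_area DIM('a)) (at 1)"
    by (auto intro!: derivative_eq_intros simp: unit_sphere_area_def)
  then show ?thesis
    by (rule has_field_derivative_transform_within_open[where S = "{0<..}"])
       (auto simp: content_ball)
qed

end

theory Submission
  imports Defs
begin

text \<open>Write \<open>\<Psi> z = 2 \<kappa>'(\<parallel>z\<parallel>\<^sup>2) z\<close> for the gradient of \<open>\<kappa>(\<parallel>z\<parallel>\<^sup>2)\<close>. Differentiating under the integral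
  and substituting \<open>y = x - \<surd>t z\<close> gives \<open>\<nabla>\<^sub>x h(t, x) = t powr (-1/2) \<integral> \<Psi> z dz\<close> over the set of all \<open>z\<close> with
  \<open>x - \<surd>t z \<in> A\<close>. As \<open>t \<rightarrow> 0\<close> this set approaches the half space \<open>z \<bullet> n x > 0\<close>: near \<open>p\<close> the boundary
  is a level set of a \<open>C\<^sup>1\<close> function with nonvanishing gradient, so for every \<open>\<epsilon>\<close> the two sets agree in a
  ball outside the slab \<open>\<bar>z \<bullet> n x\<bar> < \<epsilon>\<close> once \<open>t\<close> is small, uniformly in \<open>x\<close>. The integral of \<open>\<parallel>\<Psi>\<parallel>\<close> over
  the slab does not depend on the direction of its normal, which makes the error uniform. Over the half
  space, all components of \<open>\<integral> \<Psi>\<close> orthogonal to \<open>n x\<close> vanish by reflection; in the normal direction \<open>\<Psi>\<close> is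
  the derivative of \<open>\<kappa>(\<parallel>z\<parallel>\<^sup>2)\<close>, and Fubini leaves minus the integral of \<open>\<kappa>(\<parallel>z'\<parallel>\<^sup>2)\<close> over the hyperplane,
  which is \<open>-\<xi>\<close> in polar coordinates.\<close>

subsection \<open>Isometries and Lebesgue measure\<close>

lemma nn_integral_lborel_translate:
  fixes f :: "'a::euclidean_space \<Rightarrow> ennreal"
  assumes [measurable]: "f \<in> borel_measurable borel"
  shows "(\<integral>\<^sup>+x. f (c + x) \<partial>lborel) = (\<integral>\<^sup>+x. f x \<partial>lborel)"
proof -
  have "(\<integral>\<^sup>+x. f x \<partial>lborel) = (\<integral>\<^sup>+x. f x \<partial>distr lborel borel ((+) c))"
    by (simp add: lborel_distr_plus)
  then show ?thesis
    by (simp add: nn_integral_distr)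
qed

text \<open>Uniqueness of Haar measure: average \<open>indicator X\<close> against the indicator of a unit ball,
  which every orthogonal map preserves, and exchange the order of integration.\<close>

lemma lborel_distr_orthogonal_transformation:
  fixes T :: "'a::euclidean_space \<Rightarrow> 'a"
  assumes T: "orthogonal_transformation T"
  shows "distr lborel borel T = lborel"
proof (rule measure_eqI)
  show "sets (distr lborel borel T) = sets lborel" by simp
next
  fix X assume "X \<in> sets (distr lborel borel T)"
  then have X[measurable]: "X \<in> sets borel" by simp
  have lin: "linear T"
    using T by (rule orthogonal_transformation_linear)
  have [measurable]: "T \<in> borel_measurable borel"
    using lin by (intro borel_measurable_continuous_onI linear_continuous_on linear_conv_bounded_linear[THEN iffD1])
  define B where "B = ball (0::'a) 1"
  have [measurable]: "B \<in> sets borel" by (simp add: B_def)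
  define m where "m = emeasure lborel B"
  \<comment> \<open>Both facts serve the final cancellation of \<open>m\<close>, which must be
    neither zero nor infinite.\<close>
  have m: "m \<noteq> 0" "m \<noteq> \<infinity>"
    by (simp_all add: m_def B_def emeasure_ball less_imp_neq[THEN not_sym])
  \<comment> \<open>Writing a vector \<open>y\<close> as \<open>T (S y)\<close> moves the
    translation by \<open>y\<close> inside \<open>T\<close>, where translation invariance of
    Lebesgue measure absorbs it.\<close>
  obtain S where S: "\<And>y. T (S y) = y"
    using orthogonal_transformation_surj[OF T] by (metis surj_f_inv_f)
  have TX: "emeasure (distr lborel borel T) X = (\<integral>\<^sup>+x. indicator X (T x) \<partial>lborel)"
    by (simp add: nn_integral_distr flip: nn_integral_indicator)
  have "m * (\<integral>\<^sup>+x. indicator X (T x) \<partial>lborel) =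
      (\<integral>\<^sup>+y. indicator B y * (\<integral>\<^sup>+x. indicator X (T x) \<partial>lborel) \<partial>lborel)"
    by (simp add: m_def nn_integral_multc)
  also have "\<dots> = (\<integral>\<^sup>+y. (\<integral>\<^sup>+x. indicator B y * indicator X (y + T x) \<partial>lborel) \<partial>lborel)"
  proof (intro nn_integral_cong)
    fix y
    have "(\<integral>\<^sup>+x. indicator X (T x) \<partial>lborel) = (\<integral>\<^sup>+x. indicator X (T (S y + x)) \<partial>lborel)"
      by (subst nn_integral_lborel_translate[where f = "\<lambda>x. indicator X (T x)"]) auto
    then show "indicator B y * (\<integral>\<^sup>+x. indicator X (T x) \<partial>lborel) =
        (\<integral>\<^sup>+x. indicator B y * indicator X (y + T x) \<partial>lborel)"
      by (simp add: linear_add[OF lin] S nn_integral_cmult)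
  qed
  also have "\<dots> = (\<integral>\<^sup>+x. (\<integral>\<^sup>+y. indicator B y * indicator X (y + T x) \<partial>lborel) \<partial>lborel)"
    by (rule lborel_pair.Fubini') measurable
  also have "\<dots> = (\<integral>\<^sup>+x. (\<integral>\<^sup>+y. indicator B (y - T x) * indicator X y \<partial>lborel) \<partial>lborel)"
  proof (rule nn_integral_cong)
    fix x
    show "(\<integral>\<^sup>+y. indicator B y * indicator X (y + T x) \<partial>lborel) =
        (\<integral>\<^sup>+y. indicator B (y - T x) * indicator X y \<partial>lborel)"
      by (subst nn_integral_lborel_translate[of _ "T x", symmetric]) (auto simp: add.commute)
  qed
  also have "\<dots> = (\<integral>\<^sup>+y. (\<integral>\<^sup>+x. indicator B (y - T x) * indicator X y \<partial>lborel) \<partial>lborel)"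
    by (rule lborel_pair.Fubini') measurable
  also have "\<dots> = (\<integral>\<^sup>+y. m * indicator X y \<partial>lborel)"
  proof (intro nn_integral_cong)
    fix y
    \<comment> \<open>\<open>T\<close> preserves distances, so the unit ball about \<open>y\<close>
      pulls back to the unit ball about \<open>S y\<close>, which again has volume
      \<open>m\<close>.\<close>
    have "indicator B (y - T x) = (indicator (ball (S y) 1) x :: ennreal)" for x
    proof -
      have "norm (T x - y) = norm (T (S y - x))"
        by (simp add: linear_diff[OF lin] S norm_minus_commute)
      then show ?thesis
        using orthogonal_transformation_norm[OF T, of "S y - x"] by (simp add: B_def dist_norm indicator_def norm_minus_commute)
    qed
    then have "(\<integral>\<^sup>+x. indicator B (y - T x) * indicator X y \<partial>lborel) =
        (\<integral>\<^sup>+x. indicator (ball (S y) 1) x * indicator X y \<partial>lborel)"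
      by simp
    also have "\<dots> = emeasure lborel (ball (S y) 1) * indicator X y"
      by (subst nn_integral_multc) (simp_all add: borel_measurable_indicator)
    finally show "(\<integral>\<^sup>+x. indicator B (y - T x) * indicator X y \<partial>lborel) = m * indicator X y"
      by (simp add: m_def B_def emeasure_ball)
  qed
  also have "\<dots> = m * emeasure lborel X"
    by (simp add: nn_integral_cmult)
  finally show "emeasure (distr lborel borel T) X = emeasure lborel X"
    unfolding TX using m by (simp add: ennreal_mult_cancel_left)
qed

lemma integral_lborel_orthogonal:
  fixes T :: "'a::euclidean_space \<Rightarrow> 'a" and f :: "'a \<Rightarrow> 'b::{banach, second_countable_topology}"
  assumes T: "orthogonal_transformation T" and f[measurable]: "f \<in> borel_measurable borel"
  shows "(LINT x|lborel. f (T x)) = (LINT x|lborel. f x)"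
proof -
  have [measurable]: "T \<in> borel_measurable borel"
    using T by (intro borel_measurable_continuous_onI linear_continuous_on
        linear_conv_bounded_linear[THEN iffD1] orthogonal_transformation_linear)
  show ?thesis
    using integral_distr[of T lborel borel f] by (simp add: lborel_distr_orthogonal_transformation[OF T])
qed

subsection \<open>Differentiation of convolutions with indicators\<close>

lemma lborel_distr_diff: "distr lborel borel (\<lambda>y. x - y) = (lborel :: 'a::euclidean_space measure)"
  using lborel_affine[of "-1" x] by (simp add: density_1)

lemma nn_integral_lborel_diff:
  fixes f :: "'a::euclidean_space \<Rightarrow> ennreal"
  assumes [measurable]: "f \<in> borel_measurable borel"
  shows "(\<integral>\<^sup>+y. f (x - y) \<partial>lborel) = (\<integral>\<^sup>+y. f y \<partial>lborel)"
  using nn_integral_distr[of "\<lambda>y. x - y" lborel borel f] by (simp add: lborel_distr_diff)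

lemma
  fixes f :: "'a::euclidean_space \<Rightarrow> 'b::{banach, second_countable_topology}"
  assumes [measurable]: "f \<in> borel_measurable borel"
  shows integral_lborel_diff: "(LINT y|lborel. f (x - y)) = (LINT y|lborel. f y)"
    and integrable_lborel_diff: "integrable lborel (\<lambda>y. f (x - y)) \<longleftrightarrow> integrable lborel f"
  using integral_distr[of "\<lambda>y. x - y" lborel borel f] integrable_distr_eq[of "\<lambda>y. x - y" lborel borel f]
  by (simp_all add: lborel_distr_diff)

text \<open>The index set may be uncountable, so measurability comes from topology: strict
  superlevel sets are unions of open sets. This serves the local suprema in condition
  (\<kappa>2).\<close>

lemma borel_measurable_SUP_continuous:
  fixes f :: "'i \<Rightarrow> 'a::topological_space \<Rightarrow> ennreal"
  assumes "\<And>i. i \<in> I \<Longrightarrow> continuous_on UNIV (f i)"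
  shows "(\<lambda>x. SUP i\<in>I. f i x) \<in> borel_measurable borel"
proof (rule borel_measurableI_greater)
  fix y
  have "{x. y < (SUP i\<in>I. f i x)} = (\<Union>i\<in>I. {x. y < f i x})"
    by (auto simp: less_SUP_iff)
  moreover have "open (\<Union>i\<in>I. {x. y < f i x})"
    using assms by (intro open_UN ballI open_Collect_less continuous_on_const) auto
  ultimately show "{x \<in> space borel. y < (SUP i\<in>I. f i x)} \<in> sets borel"
    by simp
qed

text \<open>Dominated convergence for difference quotients. The mean value inequality bounds them by
  the supremum of the gradient norm over a unit ball, and this local supremum is integrable by
  hypothesis.\<close>

lemma GDERIV_convolution:
  fixes \<psi> :: "'a::euclidean_space \<Rightarrow> real" and \<Psi> :: "'a \<Rightarrow> 'a"
  assumes deriv: "\<And>w. GDERIV \<psi> w :> \<Psi> w"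
    and cont: "continuous_on UNIV \<Psi>"
    and int: "integrable lborel \<psi>"
    and dom: "(\<integral>\<^sup>+x. (SUP b\<in>cball 0 1. ennreal (norm (\<Psi> (x + b)))) \<partial>lborel) < \<infinity>"
    and A[measurable]: "A \<in> sets borel"
  shows "GDERIV (\<lambda>x. LINT y:A|lborel. \<psi> (x - y)) x :> (LINT y:A|lborel. \<Psi> (x - y))"
proof -
  have D: "(\<psi> has_derivative (\<lambda>h. h \<bullet> \<Psi> w)) (at w)" for w
    using deriv by (simp add: gderiv_def)
  have [measurable]: "\<Psi> \<in> borel_measurable borel"
    using cont by (rule borel_measurable_continuous_onI)
  have [measurable]: "\<psi> \<in> borel_measurable borel"
    using borel_measurable_integrable[OF int] by simp
  define S where "S w = (SUP b\<in>cball 0 1. ennreal (norm (\<Psi> (w + b))))" for w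
  have [measurable]: "S \<in> borel_measurable borel"
    unfolding S_def
    by (intro borel_measurable_SUP_continuous continuous_on_ennreal continuous_on_norm
        continuous_on_compose2[OF cont] continuous_intros) auto
  have S_fin: "(\<integral>\<^sup>+y. S (x - y) \<partial>lborel) < \<infinity>"
    using dom by (simp add: nn_integral_lborel_diff S_def[symmetric])
  then have AE_fin: "AE y in lborel. S (x - y) \<noteq> \<infinity>"
    by (intro nn_integral_PInf_AE) auto
  \<comment> \<open>\<open>S\<close> may be infinite on a null set, where \<open>enn2real\<close>
    returns 0; bounds by \<open>d\<close> are therefore proved where \<open>S\<close> is finite and
    used almost everywhere.\<close>
  define d where "d y = enn2real (S (x - y))" for y
  have [measurable]: "d \<in> borel_measurable borel" by (simp add: d_def[abs_def])
  have d_int: "integrable lborel d"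
  proof (rule integrableI_nonneg)
    have "(\<integral>\<^sup>+y. ennreal (d y) \<partial>lborel) = (\<integral>\<^sup>+y. S (x - y) \<partial>lborel)"
      using AE_fin by (intro nn_integral_cong_AE) (auto simp: d_def less_top)
    then show "(\<integral>\<^sup>+y. ennreal (d y) \<partial>lborel) < \<infinity>" using S_fin by simp
  qed (auto simp: d_def)
  have \<Psi>_le: "norm (\<Psi> (x - y + b)) \<le> d y" if "S (x - y) \<noteq> \<infinity>" "norm b \<le> 1" for y b
  proof -
    have "ennreal (norm (\<Psi> (x - y + b))) \<le> S (x - y)"
      unfolding S_def using that(2) by (intro SUP_upper2[of b]) auto
    also have "\<dots> = ennreal (d y)" using that(1) by (simp add: d_def less_top)
    finally show ?thesis by (simp add: d_def)
  qed
  have \<Psi>_int: "set_integrable lborel A (\<lambda>y. \<Psi> (x - y))"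
    unfolding set_integrable_def
  proof (rule Bochner_Integration.integrable_bound[OF d_int])
    show "AE y in lborel. norm (indicator A y *\<^sub>R \<Psi> (x - y)) \<le> norm (d y)"
      using AE_fin
    proof eventually_elim
      case (elim y)
      then show ?case using \<Psi>_le[of y 0] by (auto simp: indicator_def)
    qed
  qed measurable
  have \<psi>_int: "set_integrable lborel A (\<lambda>y. \<psi> (z - y))" for z
    using int A integrable_lborel_diff[of \<psi> z]
    unfolding set_integrable_def by (intro integrable_mult_indicator) auto
  have \<psi>_le: "\<bar>\<psi> (z - y) - \<psi> (x - y)\<bar> \<le> d y * norm (z - x)"
    if "S (x - y) \<noteq> \<infinity>" "z \<in> ball x 1" for y z
  proof -
    have "norm (\<psi> (z - y) - \<psi> (x - y)) \<le> d y * norm ((z - y) - (x - y))"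
    proof (rule differentiable_bound)
      show "convex (cball (x - y) 1)" by simp
      show "(\<psi> has_derivative (\<lambda>h. h \<bullet> \<Psi> w)) (at w within cball (x - y) 1)" for w
        using D by (rule has_derivative_at_withinI)
      show "onorm (\<lambda>h. h \<bullet> \<Psi> w) \<le> d y" if "w \<in> cball (x - y) 1" for w
      proof (rule onorm_le)
        have "norm (\<Psi> w) \<le> d y"
          using \<Psi>_le[OF \<open>S (x - y) \<noteq> \<infinity>\<close>, of "w - (x - y)"] that
          by (simp add: dist_norm norm_minus_commute)
        then show "norm (h \<bullet> \<Psi> w) \<le> d y * norm h" for h
          using Cauchy_Schwarz_ineq2[of h "\<Psi> w"]
          by (metis mult.commute mult_left_mono norm_ge_zero order_trans real_norm_def)
      qed
    qed (use that in \<open>auto simp: dist_norm norm_minus_commute\<close>)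
    then show ?thesis by simp
  qed
  let ?H = "\<lambda>x. LINT y:A|lborel. \<psi> (x - y)"
  let ?G = "LINT y:A|lborel. \<Psi> (x - y)"
  \<comment> \<open>Staying in \<open>ball x 1\<close> keeps the segment from \<open>x - y\<close>
    to \<open>z - y\<close> in the ball over which \<open>S\<close> takes its supremum. Passing to
    sequences makes dominated convergence applicable.\<close>
  have "(?H has_derivative (\<lambda>h. h \<bullet> ?G)) (at x within ball x 1)"
    unfolding has_derivative_iff_norm tendsto_at_iff_sequentially
  proof (intro conjI allI impI)
    show "bounded_linear (\<lambda>h. h \<bullet> ?G)" by (rule bounded_linear_inner_left)
  next
    fix X assume X: "\<forall>i. X i \<in> ball x 1 - {x}" and lim: "X \<longlonglongrightarrow> x"
    define q where "q i y = indicator A y *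
      ((\<psi> (X i - y) - \<psi> (x - y) - (X i - x) \<bullet> \<Psi> (x - y)) / norm (X i - x))" for i y
    have q_int: "(?H (X i) - ?H x - (X i - x) \<bullet> ?G) / norm (X i - x) = (LINT y|lborel. q i y)" for i
    proof -
      have "(X i - x) \<bullet> ?G = (LINT y|lborel. indicator A y * ((X i - x) \<bullet> \<Psi> (x - y)))"
        using integral_inner_right[of "X i - x" lborel "\<lambda>y. indicator A y *\<^sub>R \<Psi> (x - y)"] \<Psi>_int
        by (simp add: set_lebesgue_integral_def set_integrable_def)
      moreover have "integrable lborel (\<lambda>y. indicator A y * ((X i - x) \<bullet> \<Psi> (x - y)))"
        using integrable_inner_right[of "X i - x" lborel "\<lambda>y. indicator A y *\<^sub>R \<Psi> (x - y)"] \<Psi>_int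
        by (simp add: set_integrable_def)
      ultimately show ?thesis
        using \<psi>_int[of "X i"] \<psi>_int[of x]
        by (simp add: q_def set_lebesgue_integral_def set_integrable_def right_diff_distrib diff_divide_distrib)
    qed
    have "(\<lambda>i. LINT y|lborel. q i y) \<longlonglongrightarrow> (LINT y::'a|lborel. (0::real))"
    \<comment> \<open>One \<open>d y\<close> bounds the difference quotient, the other the
      subtracted linear term.\<close>
    proof (rule integral_dominated_convergence[where s = q and w = "\<lambda>y. 2 * d y"])
      show "integrable lborel (\<lambda>y. 2 * d y)" using d_int by simp
      show "AE y in lborel. (\<lambda>i. q i y) \<longlonglongrightarrow> 0"
      proof (rule AE_I2)
        fix y
        have "((\<lambda>z. \<psi> (z - y)) has_derivative (\<lambda>h. h \<bullet> \<Psi> (x - y))) (at x)"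
          by (rule has_derivative_compose[where f = "\<lambda>z. z - y" and f' = "\<lambda>h. h", OF _ D])
             (auto intro!: derivative_eq_intros)
        then have "((\<lambda>z. norm (\<psi> (z - y) - \<psi> (x - y) - (z - x) \<bullet> \<Psi> (x - y)) / norm (z - x)) \<longlongrightarrow> 0) (at x)"
          by (simp add: has_derivative_iff_norm)
        then have "(\<lambda>i. norm (\<psi> (X i - y) - \<psi> (x - y) - (X i - x) \<bullet> \<Psi> (x - y)) / norm (X i - x)) \<longlonglongrightarrow> 0"
          using X lim unfolding tendsto_at_iff_sequentially comp_def by auto
        then have "(\<lambda>i. indicator A y * (norm (\<psi> (X i - y) - \<psi> (x - y) - (X i - x) \<bullet> \<Psi> (x - y)) / norm (X i - x))) \<longlonglongrightarrow> 0"
          by (rule tendsto_mult_right_zero)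
        then have "(\<lambda>i. norm (q i y)) \<longlonglongrightarrow> 0"
          by (simp add: q_def abs_mult)
        then show "(\<lambda>i. q i y) \<longlonglongrightarrow> 0" by (rule tendsto_norm_zero_cancel)
      qed
      show "AE y in lborel. norm (q i y) \<le> 2 * d y" for i
        using AE_fin
      proof eventually_elim
        case (elim y)
        have pos: "norm (X i - x) > 0" using X by auto
        have "\<bar>(X i - x) \<bullet> \<Psi> (x - y)\<bar> \<le> norm (X i - x) * d y"
          using Cauchy_Schwarz_ineq2[of "X i - x" "\<Psi> (x - y)"] \<Psi>_le[OF elim, of 0]
          by (simp add: mult_left_mono order_trans)
        moreover have "\<bar>\<psi> (X i - y) - \<psi> (x - y)\<bar> \<le> d y * norm (X i - x)"
          using X by (intro \<psi>_le[OF elim]) auto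
        ultimately have "\<bar>\<psi> (X i - y) - \<psi> (x - y) - (X i - x) \<bullet> \<Psi> (x - y)\<bar> \<le> 2 * d y * norm (X i - x)"
          by (simp add: algebra_simps)
        then show ?case
          using pos by (auto simp: q_def indicator_def divide_le_eq d_def)
      qed
    qed (simp_all add: q_def[abs_def])
    then have "(\<lambda>i. norm ((?H (X i) - ?H x - (X i - x) \<bullet> ?G) / norm (X i - x))) \<longlonglongrightarrow> 0"
      unfolding q_int by (intro tendsto_norm_zero) simp
    then show "((\<lambda>z. norm (?H z - ?H x - (z - x) \<bullet> ?G) / norm (z - x)) \<circ> X) \<longlonglongrightarrow> 0"
      by (simp add: comp_def norm_divide)
  qed
  moreover have "at x within ball x 1 = at x"
    by (rule at_within_open) auto
  ultimately show ?thesis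
    unfolding gderiv_def by simp
qed

lemma GDERIV_radial:
  fixes w :: "'a::real_inner"
  assumes "\<And>r. r \<ge> 0 \<Longrightarrow> (\<kappa> has_real_derivative \<kappa>' r) (at r within {0..})"
  shows "GDERIV (\<lambda>w. \<kappa> ((norm w)\<^sup>2)) w :> (2 * \<kappa>' ((norm w)\<^sup>2)) *\<^sub>R w"
proof -
  have "((\<lambda>w::'a. (norm w)\<^sup>2) has_derivative (\<lambda>h. 2 * (w \<bullet> h))) (at w)"
    unfolding power2_norm_eq_inner by (auto intro!: derivative_eq_intros simp: inner_commute)
  \<comment> \<open>The squared norm takes values in \<open>{0..}\<close>, so the chain rule works
    with the one-sided derivative of \<kappa>, also at \<open>w = 0\<close>.\<close>
  moreover have "(\<kappa> has_derivative (\<lambda>h. \<kappa>' ((norm w)\<^sup>2) * h)) (at ((norm w)\<^sup>2) within range (\<lambda>w::'a. (norm w)\<^sup>2))"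
    using assms[of "(norm w)\<^sup>2"] unfolding has_field_derivative_def
    by (rule has_derivative_subset) auto
  ultimately have "((\<lambda>w::'a. \<kappa> ((norm w)\<^sup>2)) has_derivative (\<lambda>h. \<kappa>' ((norm w)\<^sup>2) * (2 * (w \<bullet> h)))) (at w)"
    by (rule has_derivative_in_compose)
  then show ?thesis
    unfolding gderiv_def by (rule has_derivative_eq_rhs) (simp add: fun_eq_iff inner_commute)
qed

text \<open>The substitution \<open>y = sqrt t *\<^sub>R z\<close> cancels the power of
  \<open>t\<close> against the Jacobian and moves the dependence on \<open>t\<close> from the kernel
  to the set and the point. A single fixed kernel remains to be differentiated.\<close>

lemma kernel_integral_rescale:
  fixes A :: "(real ^ 'n::finite) set"
  assumes "t > 0" and [measurable]: "A \<in> sets borel" and cont: "continuous_on {0..} \<kappa>"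
  shows "kernel_integral A \<kappa> t x =
    (LINT y:{y. sqrt t *\<^sub>R y \<in> A}|lborel. \<kappa> ((norm (x /\<^sub>R sqrt t - y))\<^sup>2))"
proof -
  define s where "s = sqrt t"
  have s: "s > 0" "t = s\<^sup>2" using \<open>t > 0\<close> by (simp_all add: s_def)
  have c: "s ^ CARD('n) * t powr (- real CARD('n) / 2) = 1"
  proof -
    have "t powr (- real CARD('n) / 2) = s powr (2 * (- real CARD('n) / 2))"
      unfolding powr_powr[symmetric] using s by simp
    then show ?thesis
      using s by (simp add: powr_minus powr_realpow)
  qed
  have [measurable]: "(\<lambda>y. \<kappa> ((norm (x - y))\<^sup>2 / t)) \<in> borel_measurable borel"
    using \<open>t > 0\<close>
    by (intro borel_measurable_continuous_onI continuous_on_compose2[OF cont] continuous_intros) auto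
  let ?G = "\<lambda>y. indicator A y *\<^sub>R (t powr (- real CARD('n) / 2) * \<kappa> ((norm (x - y))\<^sup>2 / t))"
  have "kernel_integral A \<kappa> t x = (LINT y|lborel. ?G y)"
    unfolding kernel_integral_def set_lebesgue_integral_def ..
  also have "\<dots> = (LINT y|density (distr lborel borel (\<lambda>z. 0 + s *\<^sub>R z)) (\<lambda>_. ennreal (\<bar>s\<bar> ^ DIM(real ^ 'n))). ?G y)"
    using lborel_affine[of s "0 :: real ^ 'n"] s(1) by (intro arg_cong[where f = "\<lambda>M. integral\<^sup>L M ?G"]) simp
  also have "\<dots> = (LINT y|distr lborel borel (\<lambda>z. 0 + s *\<^sub>R z). \<bar>s\<bar> ^ DIM(real ^ 'n) *\<^sub>R ?G y)"
    by (rule integral_density) auto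
  also have "\<dots> = (LINT z|lborel. \<bar>s\<bar> ^ DIM(real ^ 'n) *\<^sub>R ?G (0 + s *\<^sub>R z))"
    by (rule integral_distr) measurable
  also have "\<dots> = (LINT z|lborel. indicator {y. s *\<^sub>R y \<in> A} z *\<^sub>R \<kappa> ((norm (x /\<^sub>R s - z))\<^sup>2))"
  proof (rule Bochner_Integration.integral_cong)
    fix z
    have "x - s *\<^sub>R z = s *\<^sub>R (x /\<^sub>R s - z)"
      using s(1) by (simp add: scaleR_diff_right)
    then have "(norm (x - s *\<^sub>R z))\<^sup>2 / t = (norm (x /\<^sub>R s - z))\<^sup>2"
      using s by (simp add: power_mult_distrib)
    then show "\<bar>s\<bar> ^ DIM(real ^ 'n) *\<^sub>R ?G (0 + s *\<^sub>R z) =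
        indicator {y. s *\<^sub>R y \<in> A} z *\<^sub>R \<kappa> ((norm (x /\<^sub>R s - z))\<^sup>2)"
      using s(1) c by (simp add: indicator_def mult.assoc[symmetric])
  qed simp
  finally show ?thesis
    by (simp add: set_lebesgue_integral_def s_def)
qed

text \<open>After rescaling, a convolution is evaluated at \<open>x /\<^sub>R sqrt t\<close>, so the
  chain rule supplies \<open>t powr (- 1 / 2)\<close>. Reflecting the integration variable turns the
  domain into the blow-up of \<open>A\<close> at \<open>x\<close>.\<close>

lemma GDERIV_kernel_integral:
  fixes A :: "(real ^ 'n::finite) set"
  assumes A[measurable]: "A \<in> sets borel"
    and deriv: "\<And>r. r \<ge> 0 \<Longrightarrow> (\<kappa> has_real_derivative \<kappa>' r) (at r within {0..})"
    and cont: "continuous_on {0..} \<kappa>'"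
    and \<kappa>_int: "integrable lborel (\<lambda>x::real ^ 'n. \<kappa> ((norm x)\<^sup>2))"
    and dom: "(\<integral>\<^sup>+x. (SUP b\<in>cball (0 :: real ^ 'n) 1. ennreal (norm (x + b) * \<bar>\<kappa>' ((norm (x + b))\<^sup>2)\<bar>)) \<partial>lborel) < \<infinity>"
    and "t > 0"
  shows "GDERIV (kernel_integral A \<kappa> t) x :> (t powr (- 1 / 2)) *\<^sub>R
    (LINT z|lborel. indicator {z. x - sqrt t *\<^sub>R z \<in> A} z *\<^sub>R ((2 * \<kappa>' ((norm z)\<^sup>2)) *\<^sub>R z))"
proof -
  let ?\<Psi> = "\<lambda>z::real ^ 'n. (2 * \<kappa>' ((norm z)\<^sup>2)) *\<^sub>R z"
  define s where "s = sqrt t"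
  have s: "s > 0" using \<open>t > 0\<close> by (simp add: s_def)
  define B where "B = {y. s *\<^sub>R y \<in> A}"
  have [measurable]: "B \<in> sets borel"
    unfolding B_def by measurable
  have \<kappa>_cont: "continuous_on {0..} \<kappa>"
    using deriv by (auto intro!: DERIV_continuous simp: continuous_on_eq_continuous_within)
  have \<Psi>_cont: "continuous_on UNIV ?\<Psi>"
    by (intro continuous_intros continuous_on_compose2[OF cont]) auto
  have [measurable]: "?\<Psi> \<in> borel_measurable borel"
    using \<Psi>_cont by (rule borel_measurable_continuous_onI)
  let ?D = "\<lambda>b x::real ^ 'n. ennreal (norm (x + b) * \<bar>\<kappa>' ((norm (x + b))\<^sup>2)\<bar>)"
  have D_meas: "(\<lambda>x. SUP b\<in>cball 0 1. ?D b x) \<in> borel_measurable borel"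
    by (intro borel_measurable_SUP_continuous continuous_on_ennreal continuous_intros
        continuous_on_compose2[OF cont]) auto
  have "(\<integral>\<^sup>+x. (SUP b\<in>cball 0 1. ennreal (norm (?\<Psi> (x + b)))) \<partial>lborel) = (\<integral>\<^sup>+x. 2 * (SUP b\<in>cball 0 1. ?D b x) \<partial>lborel)"
  proof (rule nn_integral_cong)
    fix x :: "real ^ 'n"
    have "ennreal (norm (?\<Psi> (x + b))) = 2 * ?D b x" for b
      by (simp add: abs_mult ennreal_mult' mult_ac)
    then show "(SUP b\<in>cball 0 1. ennreal (norm (?\<Psi> (x + b)))) = 2 * (SUP b\<in>cball 0 1. ?D b x)"
      by (simp add: SUP_mult_left_ennreal)
  qed
  also have "\<dots> = 2 * (\<integral>\<^sup>+x. (SUP b\<in>cball 0 1. ?D b x) \<partial>lborel)"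
    using D_meas by (intro nn_integral_cmult) simp
  also have "\<dots> < \<infinity>"
    using dom by (simp add: ennreal_mult_less_top)
  finally have dom': "(\<integral>\<^sup>+x. (SUP b\<in>cball 0 1. ennreal (norm (?\<Psi> (x + b)))) \<partial>lborel) < \<infinity>" .
  define H where "H x = (LINT y:B|lborel. \<kappa> ((norm (x - y))\<^sup>2))" for x
  define G where "G = (LINT y:B|lborel. ?\<Psi> (x /\<^sub>R s - y))"
  have "GDERIV H (x /\<^sub>R s) :> G"
    unfolding H_def[abs_def] G_def
    by (rule GDERIV_convolution[OF GDERIV_radial[OF deriv] \<Psi>_cont \<kappa>_int dom']) auto
  then have HG: "(H has_derivative (\<lambda>h. h \<bullet> G)) (at (x /\<^sub>R s))"
    by (simp add: gderiv_def)
  have "((\<lambda>x. H (x /\<^sub>R s)) has_derivative (\<lambda>h. (h /\<^sub>R s) \<bullet> G)) (at x)"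
    by (rule has_derivative_compose[where f = "\<lambda>x. x /\<^sub>R s", OF _ HG]) (auto intro!: derivative_eq_intros)
  moreover have "kernel_integral A \<kappa> t = (\<lambda>x. H (x /\<^sub>R s))"
    using kernel_integral_rescale[OF \<open>t > 0\<close> A \<kappa>_cont] by (simp add: fun_eq_iff H_def B_def s_def)
  ultimately have "GDERIV (kernel_integral A \<kappa> t) x :> G /\<^sub>R s"
    by (simp add: gderiv_def)
  moreover have "G = (LINT z|lborel. indicator {z. x - s *\<^sub>R z \<in> A} z *\<^sub>R ?\<Psi> z)"
  proof -
    \<comment> \<open>Rewriting \<open>y\<close> this way displays the integrand as a function of
      \<open>x /\<^sub>R s - y\<close> alone, the form that the reflection rule matches.\<close>
    have "G = (LINT y|lborel. indicator B (x /\<^sub>R s - (x /\<^sub>R s - y)) *\<^sub>R ?\<Psi> (x /\<^sub>R s - y))"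
      by (simp add: G_def set_lebesgue_integral_def)
    also have "\<dots> = (LINT z|lborel. indicator B (x /\<^sub>R s - z) *\<^sub>R ?\<Psi> z)"
      by (rule integral_lborel_diff) measurable
    also have "(\<lambda>z. indicator B (x /\<^sub>R s - z)) = (indicator {z. x - s *\<^sub>R z \<in> A} :: _ \<Rightarrow> real)"
      using s by (auto simp: fun_eq_iff indicator_def B_def scaleR_diff_right)
    finally show ?thesis .
  qed
  moreover have "t powr (- 1 / 2) = inverse s"
    using \<open>t > 0\<close> by (simp add: s_def powr_minus powr_half_sqrt)
  ultimately show ?thesis
    by (simp add: s_def)
qed

subsection \<open>The boundary as a level set\<close>

text \<open>As \<open>y\<close> tends to \<open>x\<close>, the local bound
  \<open>C * dist y x powr \<alpha>\<close> tends to 0 because \<alpha> is positive.\<close>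

lemma C1_Holder_on_imp_continuous_derivative:
  assumes "C1_Holder_on \<alpha> S f" "\<alpha> > 0"
  obtains f' where "\<And>x. x \<in> S \<Longrightarrow> (f has_derivative blinfun_apply (f' x)) (at x)" "continuous_on S f'"
proof -
  obtain f' where f': "\<And>x. x \<in> S \<Longrightarrow> (f has_derivative blinfun_apply (f' x)) (at x)"
    and H: "\<And>x. x \<in> S \<Longrightarrow> \<exists>W C. open W \<and> x \<in> W \<and>
      (\<forall>y\<in>S \<inter> W. \<forall>z\<in>S \<inter> W. norm (f' y - f' z) \<le> C * dist y z powr \<alpha>)"
    using assms(1) unfolding C1_Holder_on_def by blast
  have "(f' \<longlongrightarrow> f' x) (at x within S)" if x: "x \<in> S" for x
  proof -
    obtain W C where W: "open W" "x \<in> W"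
      and WC: "\<And>y. y \<in> S \<inter> W \<Longrightarrow> norm (f' y - f' x) \<le> C * dist y x powr \<alpha>"
      using H[OF x] x by blast
    have "((\<lambda>y. dist y x powr \<alpha>) \<longlongrightarrow> 0 powr \<alpha>) (at x within S)"
    proof (intro tendsto_powr' tendsto_const)
      show "((\<lambda>y. dist y x) \<longlongrightarrow> 0) (at x within S)"
        using tendsto_dist_iff[of "\<lambda>y. y" x "at x within S"] by simp
    qed (use \<open>\<alpha> > 0\<close> in auto)
    then have "((\<lambda>y. C * dist y x powr \<alpha>) \<longlongrightarrow> 0) (at x within S)"
      by (auto intro: tendsto_mult_right_zero)
    moreover have "\<forall>\<^sub>F y in at x within S. norm (f' y - f' x) \<le> C * dist y x powr \<alpha>"
      using W WC unfolding eventually_at_topological by blast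
    ultimately have "((\<lambda>y. f' y - f' x) \<longlongrightarrow> 0) (at x within S)"
      by (rule Lim_null_comparison[rotated])
    then show ?thesis by (rule LIM_zero_cancel)
  qed
  then show ?thesis
    using that[of f'] f' by (simp add: continuous_on_def)
qed

text \<open>A positive directional derivative makes \<open>f\<close> larger a short step along the
  ray. This decides on which side of a level set such a step lands.\<close>

lemma GDERIV_eventually_less:
  fixes f :: "'a::real_inner \<Rightarrow> real"
  assumes "GDERIV f z :> g" and "v \<bullet> g > 0"
  shows "\<forall>\<^sub>F s in at_right 0. f z < f (z + s *\<^sub>R v)"
proof -
  have f: "(f has_derivative (\<lambda>h. h \<bullet> g)) (at (z + 0 *\<^sub>R v))"
    using assms(1) by (simp add: gderiv_def)
  have "((\<lambda>s. f (z + s *\<^sub>R v)) has_derivative (\<lambda>s. (s *\<^sub>R v) \<bullet> g)) (at 0)"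
    by (rule has_derivative_compose[where f = "\<lambda>s. z + s *\<^sub>R v" and x = 0, OF _ f])
       (auto intro!: derivative_eq_intros)
  then have "((\<lambda>s. f (z + s *\<^sub>R v)) has_real_derivative (v \<bullet> g)) (at 0)"
    unfolding has_field_derivative_def by (rule has_derivative_eq_rhs) (simp add: fun_eq_iff)
  from DERIV_pos_inc_right[OF this assms(2)] show ?thesis
    unfolding eventually_at_right_field by auto
qed

text \<open>The defining function is coordinate \<open>k\<close> of the chart. Its gradient cannot
  vanish because the derivative of the chart is invertible, and tangent vectors are realized by
  lines in the hyperplane \<open>x $ k = 0\<close> carried back by the inverse chart.\<close>

lemma C1_Holder_surface_at_defining_function:
  fixes A :: "(real ^ 'n::finite) set"
  assumes surf: "C1_Holder_surface_at \<alpha> A p" and \<alpha>: "\<alpha> > 0" and A: "open A"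
  obtains U f g where "open U" "p \<in> U"
    "\<And>y. y \<in> U \<Longrightarrow> GDERIV f y :> g y" "continuous_on U g" "\<And>y. y \<in> U \<Longrightarrow> g y \<noteq> 0"
    "\<And>y. y \<in> U \<Longrightarrow> y \<in> A \<longleftrightarrow> f y > (0::real)"
    "\<And>y. y \<in> U \<Longrightarrow> y \<in> frontier A \<longleftrightarrow> f y = 0"
    "\<And>y v. y \<in> U \<Longrightarrow> y \<in> frontier A \<Longrightarrow> g y \<bullet> v = 0 \<Longrightarrow> tangent_vector_at (frontier A) y v"
proof -
  obtain U and \<phi> :: "real ^ 'n \<Rightarrow> real ^ 'n" and k \<psi> where pU: "p \<in> U"
    and op: "open U" "open (\<phi> ` U)" and hom: "homeomorphism U (\<phi> ` U) \<phi> \<psi>"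
    and C1: "C1_Holder_on \<alpha> U \<phi>" "C1_Holder_on \<alpha> (\<phi> ` U) \<psi>"
    and AU: "\<phi> ` (A \<inter> U) = {x \<in> \<phi> ` U. x $ k > 0}"
    using surf unfolding C1_Holder_surface_at_def C1_Holder_diffeomorphism_def by blast
  obtain \<phi>' where \<phi>': "\<And>x. x \<in> U \<Longrightarrow> (\<phi> has_derivative blinfun_apply (\<phi>' x)) (at x)"
    and \<phi>'_cont: "continuous_on U \<phi>'"
    using C1_Holder_on_imp_continuous_derivative[OF C1(1) \<alpha>] by metis
  obtain \<psi>' where \<psi>': "\<And>x. x \<in> \<phi> ` U \<Longrightarrow> (\<psi> has_derivative blinfun_apply (\<psi>' x)) (at x)"
    and \<psi>'_cont: "continuous_on (\<phi> ` U) \<psi>'"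
    using C1_Holder_on_imp_continuous_derivative[OF C1(2) \<alpha>] by metis
  have \<psi>\<phi>: "\<psi> (\<phi> x) = x" if "x \<in> U" for x
    using hom that by (simp add: homeomorphism_def)
  have \<phi>\<psi>: "\<phi> (\<psi> y) = y" "\<psi> y \<in> U" if "y \<in> \<phi> ` U" for y
    using hom that by (auto simp: homeomorphism_def)
  define f where "f y = \<phi> y $ k" for y
  define g where "g y = (\<chi> i. \<phi>' y (axis i 1) $ k)" for y
  have g: "h \<bullet> g y = \<phi>' y h $ k" for h y
  proof -
    have "\<phi>' y h = \<phi>' y (\<Sum>i\<in>UNIV. h $ i *\<^sub>R axis i 1)"
      using basis_expansion[of h] by (simp add: scalar_mult_eq_scaleR)
    then show ?thesis
      by (simp add: blinfun.sum_right blinfun.scaleR_right g_def inner_vec_def)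
  qed
  have fg: "GDERIV f y :> g y" if "y \<in> U" for y
    unfolding gderiv_def f_def g
    by (rule bounded_linear.has_derivative[OF bounded_linear_vec_nth \<phi>'[OF that]])
  have g_cont: "continuous_on U g"
    unfolding g_def by (intro continuous_intros \<phi>'_cont)
  have \<psi>'\<phi>': "\<psi>' (\<phi> y) (\<phi>' y h) = h" if y: "y \<in> U" for y h
  proof -
    have "((\<lambda>x. \<psi> (\<phi> x)) has_derivative (\<lambda>h. \<psi>' (\<phi> y) (\<phi>' y h))) (at y)"
      using has_derivative_compose[OF \<phi>'[OF y] \<psi>'[of "\<phi> y"]] y by simp
    then have "((\<lambda>x. x) has_derivative (\<lambda>h. \<psi>' (\<phi> y) (\<phi>' y h))) (at y)"
      by (rule has_derivative_transform_within_open[OF _ op(1) y]) (simp add: \<psi>\<phi>)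
    from has_derivative_unique[OF this has_derivative_ident] show ?thesis by metis
  qed
  have \<phi>'\<psi>': "\<phi>' (\<psi> z) (\<psi>' z h) = h" if z: "z \<in> \<phi> ` U" for z h
  proof -
    have "((\<lambda>x. \<phi> (\<psi> x)) has_derivative (\<lambda>h. \<phi>' (\<psi> z) (\<psi>' z h))) (at z)"
      using has_derivative_compose[OF \<psi>'[OF z] \<phi>'[of "\<psi> z"]] \<phi>\<psi>[OF z] by simp
    then have "((\<lambda>x. x) has_derivative (\<lambda>h. \<phi>' (\<psi> z) (\<psi>' z h))) (at z)"
      by (rule has_derivative_transform_within_open[OF _ op(2) z]) (simp add: \<phi>\<psi>)
    from has_derivative_unique[OF this has_derivative_ident] show ?thesis by metis
  qed
  have g_nz: "g y \<noteq> 0" if y: "y \<in> U" for y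
  proof
    assume "g y = 0"
    \<comment> \<open>The derivative of the inverse chart sends the axis vector to a direction in
      which \<open>f\<close> has derivative 1.\<close>
    moreover have "\<psi>' (\<phi> y) (axis k 1) \<bullet> g y = 1"
      using \<phi>'\<psi>'[of "\<phi> y" "axis k 1"] y by (simp add: g \<psi>\<phi>)
    ultimately show False by simp
  qed
  have fA: "y \<in> A \<longleftrightarrow> f y > 0" if y: "y \<in> U" for y
  proof
    assume "y \<in> A"
    then have "\<phi> y \<in> \<phi> ` (A \<inter> U)" using y by blast
    then show "f y > 0" unfolding AU by (simp add: f_def)
  next
    assume "f y > 0"
    then have "\<phi> y \<in> \<phi> ` (A \<inter> U)" unfolding AU using y by (simp add: f_def)
    then obtain a where "a \<in> A" "a \<in> U" "\<phi> a = \<phi> y" by auto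
    then show "y \<in> A" using \<psi>\<phi> y by metis
  qed
  have fF: "y \<in> frontier A \<longleftrightarrow> f y = 0" if y: "y \<in> U" for y
  proof
    assume fr: "y \<in> frontier A"
    have "f y \<le> 0"
      using fr fA[OF y] A by (auto simp: frontier_def interior_open)
    \<comment> \<open>By continuity a negative value would persist in a neighbourhood, which would
      then miss \<open>A\<close>.\<close>
    moreover have "\<not> f y < 0"
    proof
      assume "f y < 0"
      have "isCont f y"
        using fg[OF y] has_derivative_continuous unfolding gderiv_def by blast
      then have "\<forall>\<^sub>F z in nhds y. f z < 0"
        using \<open>f y < 0\<close> by (intro order_tendstoD) (auto simp: isCont_def tendsto_at_iff_tendsto_nhds)
      moreover have "\<forall>\<^sub>F z in nhds y. z \<in> U"
        using op(1) y by (rule eventually_nhds_in_open)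
      ultimately have "\<forall>\<^sub>F z in nhds y. z \<notin> A"
        by eventually_elim (simp add: fA)
      then have "y \<notin> closure A"
        unfolding eventually_nhds by (meson closure_iff_nhds_not_empty disjoint_iff subset_refl)
      then show False using fr by (simp add: frontier_def)
    qed
    ultimately show "f y = 0" by simp
  next
    assume 0: "f y = 0"
    \<comment> \<open>Steps along the gradient approach \<open>y\<close> from inside
      \<open>A\<close>, so \<open>y\<close> is in the closure; since \<open>f y = 0\<close> it is
      not in the open set \<open>A\<close> itself.\<close>
    have "\<forall>\<^sub>F s in at_right 0. f y < f (y + s *\<^sub>R g y)"
      using g_nz[OF y] by (intro GDERIV_eventually_less[OF fg[OF y]]) simp
    moreover have lim: "((\<lambda>s. y + s *\<^sub>R g y) \<longlongrightarrow> y) (at_right 0)"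
      by (auto intro!: tendsto_eq_intros)
    then have "\<forall>\<^sub>F s in at_right 0. y + s *\<^sub>R g y \<in> U"
      using op(1) y by (rule topological_tendstoD)
    ultimately have "\<forall>\<^sub>F s in at_right 0. y + s *\<^sub>R g y \<in> A"
      by eventually_elim (simp add: fA 0)
    then have "\<forall>\<^sub>F s in at_right 0. y + s *\<^sub>R g y \<in> closure A"
      by eventually_elim (use closure_subset in blast)
    then have "y \<in> closure A"
      using lim by (intro Lim_in_closed_set[OF closed_closure]) auto
    then show "y \<in> frontier A"
      using fA[OF y] 0 A by (simp add: frontier_def interior_open)
  qed
  have tangent: "tangent_vector_at (frontier A) y v"
    if y: "y \<in> U" "y \<in> frontier A" and v: "g y \<bullet> v = 0" for y v
  proof -
    define w where "w = \<phi>' y v"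
    \<comment> \<open>A vector orthogonal to the gradient has an image with zero component
      \<open>k\<close>, so the line \<open>l\<close> stays on the flat image of the
      boundary.\<close>
    have wk: "w $ k = 0" using v g[of v y] by (simp add: w_def inner_commute)
    define l where "l s = \<phi> y + s *\<^sub>R w" for s :: real
    have l0: "l 0 = \<phi> y" by (simp add: l_def)
    have l_cont: "continuous_on UNIV l" unfolding l_def by (intro continuous_intros)
    then have "open (l -` (\<phi> ` U))" using op(2) by (simp add: open_vimage)
    moreover have "0 \<in> l -` (\<phi> ` U)" using y l0 by simp
    ultimately obtain \<epsilon> where \<epsilon>: "\<epsilon> > 0" "ball 0 \<epsilon> \<subseteq> l -` (\<phi> ` U)"
      by (meson openE)
    then have lU: "l s \<in> \<phi> ` U" if "s \<in> {-\<epsilon><..<\<epsilon>}" for s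
      using that by (auto simp: subset_iff)
    have deriv: "((\<lambda>s. \<psi> (l s)) has_vector_derivative \<psi>' (l s) w) (at s)" if "s \<in> {-\<epsilon><..<\<epsilon>}" for s
    proof -
      have "(l has_derivative (\<lambda>s. s *\<^sub>R w)) (at s)"
        unfolding l_def by (auto intro!: derivative_eq_intros)
      from has_derivative_compose[OF this \<psi>'[OF lU[OF that]]] show ?thesis
        by (simp add: has_vector_derivative_def blinfun.scaleR_right)
    qed
    have "(\<lambda>s. \<psi> (l s)) C1_differentiable_on {-\<epsilon><..<\<epsilon>}"
      unfolding C1_differentiable_on_def
    proof (intro exI conjI ballI)
      show "continuous_on {-\<epsilon><..<\<epsilon>} (\<lambda>s. \<psi>' (l s) w)"
        using lU by (intro continuous_intros continuous_on_compose2[OF \<psi>'_cont]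
            continuous_on_subset[OF l_cont]) auto
    qed (rule deriv)
    moreover have "(\<lambda>s. \<psi> (l s)) ` {-\<epsilon><..<\<epsilon>} \<subseteq> frontier A"
    proof clarify
      fix s assume "s \<in> {-\<epsilon><..<\<epsilon>}"
      from lU[OF this] have "\<psi> (l s) \<in> U" "\<phi> (\<psi> (l s)) = l s" by (simp_all add: \<phi>\<psi>)
      then show "\<psi> (l s) \<in> frontier A"
        using fF[of "\<psi> (l s)"] fF[OF y(1)] y(2) wk by (simp add: f_def l_def)
    qed
    moreover have "((\<lambda>s. \<psi> (l s)) has_vector_derivative v) (at 0)"
      using deriv[of 0] \<epsilon>(1) \<psi>'\<phi>'[OF y(1), of v] by (simp add: l0 w_def)
    ultimately show ?thesis
      unfolding tangent_vector_at_def using \<epsilon>(1) y(1)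
      by (intro exI[of _ "\<lambda>s. \<psi> (l s)"] exI[of _ \<epsilon>]) (simp add: l0 \<psi>\<phi>)
  qed
  show ?thesis
    using that[OF op(1) pU fg g_cont g_nz fA fF tangent] by blast
qed

text \<open>Orthogonality to all tangent vectors forces \<nu> to be a multiple of the gradient. The
  side on which \<open>A\<close> lies then fixes the sign, and unit length fixes the factor.\<close>

lemma outward_unit_normal_at_eq:
  fixes A :: "'a::real_inner set"
  assumes normal: "outward_unit_normal_at A x \<nu>"
    and U: "open U" "x \<in> U" and fg: "GDERIV f x :> g" "f x = (0::real)"
    and fA: "\<And>y. y \<in> U \<Longrightarrow> y \<in> A \<longleftrightarrow> f y > 0"
    and tangent: "\<And>v. g \<bullet> v = 0 \<Longrightarrow> tangent_vector_at (frontier A) x v"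
    and "g \<noteq> 0"
  shows "\<nu> = - sgn g"
proof -
  \<comment> \<open>\<open>c *\<^sub>R g\<close> is the projection of \<nu> onto the gradient; the
    remainder \<open>v\<close> is tangent and turns out orthogonal to itself.\<close>
  define c where "c = (\<nu> \<bullet> g) / (g \<bullet> g)"
  define v where "v = \<nu> - c *\<^sub>R g"
  have gv: "g \<bullet> v = 0"
    using \<open>g \<noteq> 0\<close> by (simp add: v_def c_def inner_diff_right inner_commute)
  then have "\<nu> \<bullet> v = 0"
    using normal tangent by (simp add: outward_unit_normal_at_def)
  then have "v \<bullet> v = 0"
    using gv by (simp add: v_def inner_diff_left)
  then have \<nu>: "\<nu> = c *\<^sub>R g" by (simp add: v_def)
  \<comment> \<open>For positive \<open>c\<close>, \<open>f\<close> would increase along \<nu> and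
    short outward steps would enter \<open>A\<close>.\<close>
  have "\<not> c > 0"
  proof
    assume "c > 0"
    then have "\<forall>\<^sub>F s in at_right 0. f x < f (x + s *\<^sub>R \<nu>)"
      using \<open>g \<noteq> 0\<close> by (intro GDERIV_eventually_less[OF fg(1)]) (simp add: \<nu>)
    moreover have "((\<lambda>s. x + s *\<^sub>R \<nu>) \<longlongrightarrow> x) (at_right 0)"
      by (auto intro!: tendsto_eq_intros)
    then have "\<forall>\<^sub>F s in at_right 0. x + s *\<^sub>R \<nu> \<in> U"
      using U by (rule topological_tendstoD)
    moreover have "\<forall>\<^sub>F s in at_right 0. x + s *\<^sub>R \<nu> \<notin> A"
      using normal by (auto simp: outward_unit_normal_at_def elim: eventually_mono)
    ultimately have "\<forall>\<^sub>F s in at_right (0::real). False"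
      by eventually_elim (simp add: fA fg(2))
    then show False by simp
  qed
  moreover have "\<bar>c\<bar> * norm g = 1"
    using normal by (simp add: outward_unit_normal_at_def \<nu>)
  ultimately have "c = - inverse (norm g)"
    using \<open>g \<noteq> 0\<close> by (simp add: field_simps)
  then show ?thesis by (simp add: \<nu> sgn_div_norm)
qed

text \<open>On a compact ball about \<open>p\<close> the gradient is uniformly continuous and
  bounded away from 0. Away from the tangent plane the linear part therefore dominates the
  linearization error uniformly in \<open>x\<close> and decides the sign of
  \<open>f\<close>.\<close>

lemma level_set_cone_condition:
  fixes f :: "'a::euclidean_space \<Rightarrow> real"
  assumes U: "open U" "p \<in> U" and fg: "\<And>y. y \<in> U \<Longrightarrow> GDERIV f y :> g y"
    and cont: "continuous_on U g" and nz: "\<And>y. y \<in> U \<Longrightarrow> g y \<noteq> 0"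
  obtains r where "r > 0" "ball p r \<subseteq> U"
    "\<And>\<epsilon>. \<epsilon> > 0 \<Longrightarrow> \<exists>\<delta>>0. \<forall>x\<in>ball p r. \<forall>w. f x = 0 \<longrightarrow> w \<noteq> 0 \<longrightarrow> norm w < \<delta> \<longrightarrow>
       x - w \<in> U \<and> (w \<bullet> sgn (g x) \<le> - \<epsilon> * norm w \<longrightarrow> f (x - w) > 0) \<and>
       (w \<bullet> sgn (g x) \<ge> \<epsilon> * norm w \<longrightarrow> f (x - w) < 0)"
proof -
  obtain e where e: "e > 0" "cball p e \<subseteq> U"
    using U open_contains_cball by blast
  \<comment> \<open>Half the radius, so that steps shorter than \<open>r\<close> from points of
    \<open>ball p r\<close> stay in the compact ball.\<close>
  define r where "r = e / 2"
  have "continuous_on (cball p e) g"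
    using cont e(2) by (rule continuous_on_subset)
  then have ucont: "uniformly_continuous_on (cball p e) g"
    by (intro compact_uniformly_continuous) auto
  have "\<exists>z\<in>cball p e. \<forall>y\<in>cball p e. norm (g z) \<le> norm (g y)"
    using \<open>continuous_on (cball p e) g\<close> e(1)
    by (intro continuous_attains_inf continuous_on_norm) auto
  then obtain m where m: "m > 0" "\<And>y. y \<in> cball p e \<Longrightarrow> m \<le> norm (g y)"
    using nz e(2) by (metis subsetD zero_less_norm_iff)
  show thesis
  proof
    show "r > 0" "ball p r \<subseteq> U"
      using e by (auto simp: r_def subset_iff)
    fix \<epsilon> :: real assume "\<epsilon> > 0"
    \<comment> \<open>With this tolerance the linearization error is at most half of
      \<open>\<epsilon> * norm w * m\<close>, while in both sign cases the linear part has at least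
      the full size.\<close>
    then obtain d where d: "d > 0"
      "\<And>x y. x \<in> cball p e \<Longrightarrow> y \<in> cball p e \<Longrightarrow> dist y x < d \<Longrightarrow> dist (g y) (g x) < \<epsilon> * m / 2"
      using ucont m(1) unfolding uniformly_continuous_on_def
      by (metis half_gt_zero mult_pos_pos)
    define \<delta> where "\<delta> = min d r"
    show "\<exists>\<delta>>0. \<forall>x\<in>ball p r. \<forall>w. f x = 0 \<longrightarrow> w \<noteq> 0 \<longrightarrow> norm w < \<delta> \<longrightarrow>
       x - w \<in> U \<and> (w \<bullet> sgn (g x) \<le> - \<epsilon> * norm w \<longrightarrow> f (x - w) > 0) \<and>
       (w \<bullet> sgn (g x) \<ge> \<epsilon> * norm w \<longrightarrow> f (x - w) < 0)"
    proof (intro exI[of _ \<delta>] conjI ballI allI impI)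
      show "\<delta> > 0" using d(1) e(1) by (simp add: \<delta>_def r_def)
      fix x w :: 'a assume x: "x \<in> ball p r" and fx: "f x = 0" and w: "w \<noteq> 0" "norm w < \<delta>"
      have sub: "ball x \<delta> \<subseteq> cball p e"
      proof
        fix y assume "y \<in> ball x \<delta>"
        then have "dist x y < r" by (simp add: \<delta>_def)
        with x dist_triangle[of p y x] show "y \<in> cball p e"
          by (simp add: r_def)
      qed
      have x_in: "x \<in> ball x \<delta>" using le_less_trans[OF norm_ge_zero w(2)] by simp
      have w_in: "x - w \<in> ball x \<delta>" using w(2) by (simp add: dist_norm)
      show "x - w \<in> U" using w_in sub e(2) by blast
      have "norm (f (x - w) - f x - (x - w - x) \<bullet> g x) \<le> norm (x - w - x) * (\<epsilon> * m / 2)"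
      proof (rule differentiable_bound_linearization[where f' = "\<lambda>y h. h \<bullet> g y"])
        show "x + t *\<^sub>R (x - w - x) \<in> ball x \<delta>" if "t \<in> {0..1}" for t
          using convexD_alt[OF convex_ball x_in w_in, of t] that by (simp add: algebra_simps)
        show "(f has_derivative (\<lambda>h. h \<bullet> g y)) (at y within ball x \<delta>)" if "y \<in> ball x \<delta>" for y
          using fg[of y] that sub e(2) unfolding gderiv_def by (blast intro: has_derivative_at_withinI)
        show "onorm ((\<lambda>h. h \<bullet> g y) - (\<lambda>h. h \<bullet> g x)) \<le> \<epsilon> * m / 2" if y: "y \<in> ball x \<delta>" for y
        proof (rule onorm_le)
          fix h :: 'a
          have "dist (g y) (g x) < \<epsilon> * m / 2"
            using d(2)[OF subsetD[OF sub x_in] subsetD[OF sub y]] y by (simp add: \<delta>_def dist_commute)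
          then have "norm (g y - g x) \<le> \<epsilon> * m / 2"
            by (simp add: dist_norm)
          then have "norm h * norm (g y - g x) \<le> norm h * (\<epsilon> * m / 2)"
            by (rule mult_left_mono) simp
          then show "norm (((\<lambda>h. h \<bullet> g y) - (\<lambda>h. h \<bullet> g x)) h) \<le> \<epsilon> * m / 2 * norm h"
            using Cauchy_Schwarz_ineq2[of h "g y - g x"] by (simp add: inner_diff_right mult.commute)
        qed
        show "x \<in> ball x \<delta>" by (rule x_in)
      qed
      then have lin: "\<bar>f (x - w) + w \<bullet> g x\<bar> \<le> \<epsilon> * norm w * m / 2"
        by (simp add: fx mult_ac)
      have gx: "m \<le> norm (g x)" using m(2) x_in sub by blast
      have wg: "w \<bullet> g x = w \<bullet> sgn (g x) * norm (g x)"
        using less_le_trans[OF m(1) gx] by (simp add: sgn_div_norm)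
      have pos: "\<epsilon> * norm w * m > 0" using \<open>\<epsilon> > 0\<close> w(1) m(1) by simp
      have le: "\<epsilon> * norm w * m \<le> \<epsilon> * norm w * norm (g x)"
        using gx \<open>\<epsilon> > 0\<close> by (intro mult_left_mono) auto
      show "f (x - w) > 0" if "w \<bullet> sgn (g x) \<le> - \<epsilon> * norm w"
      proof -
        have "w \<bullet> g x \<le> - (\<epsilon> * norm w * norm (g x))"
          using mult_right_mono[OF that, of "norm (g x)"] by (simp add: wg)
        with lin pos le show ?thesis by linarith
      qed
      show "f (x - w) < 0" if "w \<bullet> sgn (g x) \<ge> \<epsilon> * norm w"
      proof -
        have "w \<bullet> g x \<ge> \<epsilon> * norm w * norm (g x)"
          using mult_right_mono[OF that, of "norm (g x)"] by (simp add: wg)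
        with lin pos le show ?thesis by linarith
      qed
    qed
  qed
qed

subsection \<open>Integrals over half spaces\<close>

text \<open>Polar coordinates for radial functions: both measures give \<open>{..a}\<close> the
  volume of the ball of radius \<open>a\<close>, and the density is the derivative of that volume.
  The product over an index set fits the coordinates that remain after Fubini has split one
  off.\<close>

lemma distr_PiM_lborel_norm:
  fixes B :: "'i set"
  assumes B: "finite B" "B \<noteq> {}"
  shows "distr (Pi\<^sub>M B (\<lambda>_. lborel)) borel (\<lambda>x. sqrt (\<Sum>i\<in>B. (x i)\<^sup>2)) =
    density lborel (\<lambda>r::real. ennreal (indicator {0..} r * (unit_sphere_area (card B) * r ^ (card B - 1))))"
    (is "?L = ?R")
proof (rule measure_eqI_generator_eq)
  interpret product_sigma_finite "\<lambda>_::'i. lborel :: real measure"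
    by standard
  let ?E = "range (\<lambda>a::real. {..a})"
  let ?n = "\<lambda>x::'i \<Rightarrow> real. sqrt (\<Sum>i\<in>B. (x i)\<^sup>2)"
  define m where "m = card B"
  have m: "m > 0" using B by (simp add: m_def card_gt_0_iff)
  show "Int_stable ?E"
    by (auto simp: Int_stable_def)
  show "?E \<subseteq> Pow UNIV" by simp
  show "sets ?L = sigma_sets UNIV ?E" "sets ?R = sigma_sets UNIV ?E"
    by (simp_all add: borel_eq_atMost)
  have L: "emeasure ?L {..a} = emeasure (Pi\<^sub>M B (\<lambda>_. lborel)) ({x. ?n x \<le> a} \<inter> space (Pi\<^sub>M B (\<lambda>_. lborel)))" for a
    by (subst emeasure_distr, measurable) (simp_all only: vimage_def atMost_iff)
  have L_pos: "emeasure ?L {..a} = ennreal (unit_ball_vol (real m) * a ^ m)" if "a > 0" for a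
    unfolding L m_def using that B by (intro emeasure_cball_aux) auto
  have n_nonneg: "?n x \<ge> 0" for x by (simp add: sum_nonneg)
  have L_eq: "emeasure ?L {..a} = (if a < 0 then 0 else ennreal (unit_ball_vol (real m) * a ^ m))" for a
  proof (cases a "0::real" rule: linorder_cases)
    case less
    then have "\<not> ?n x \<le> a" for x
      using n_nonneg[of x] by linarith
    then have "{x. ?n x \<le> a} = {}" by blast
    then show ?thesis using less by (simp only: L Int_empty_left emeasure_empty if_True)
  next
    \<comment> \<open>The ball volume rule is applied for positive radii. At radius 0 the set is a
      single point, null because \<open>B\<close> is nonempty.\<close>
    case equal
    have "{x. ?n x \<le> 0} \<inter> space (Pi\<^sub>M B (\<lambda>_. lborel)) = Pi\<^sub>E B (\<lambda>_. {0})"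
    proof -
      have "(\<Sum>i\<in>B. (x i)\<^sup>2) \<le> 0 \<longleftrightarrow> (\<forall>i\<in>B. x i = 0)" for x :: "'i \<Rightarrow> real"
      proof -
        have "(\<Sum>i\<in>B. (x i)\<^sup>2) = 0 \<longleftrightarrow> (\<forall>i\<in>B. x i = 0)"
          using B(1) by (simp add: sum_nonneg_eq_0_iff)
        moreover have "(\<Sum>i\<in>B. (x i)\<^sup>2) \<ge> 0"
          by (simp add: sum_nonneg)
        ultimately show ?thesis by linarith
      qed
      then show ?thesis
        by (auto simp: space_PiM PiE_def Pi_def extensional_def)
    qed
    moreover have "emeasure (Pi\<^sub>M B (\<lambda>_. lborel)) (Pi\<^sub>E B (\<lambda>_. {0::real})) = (\<Prod>i\<in>B. emeasure lborel {0::real})"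
      by (rule emeasure_PiM) (use B(1) in auto)
    moreover have "(\<Prod>i\<in>B. emeasure lborel {0::real}) = 0"
      using m by (simp add: m_def)
    ultimately have "emeasure ?L {..0} = 0"
      unfolding L by (simp only:)
    then show ?thesis
      unfolding equal using m by (simp only: power_0_left) simp
  qed (simp add: L_pos)
  have R_eq: "emeasure ?R {..a} = (if a < 0 then 0 else ennreal (unit_ball_vol (real m) * a ^ m))" for a
  proof -
    have "emeasure ?R {..a} = (\<integral>\<^sup>+r. ennreal (unit_sphere_area m * r ^ (m - 1)) * indicator {0..a} r \<partial>lborel)"
      by (subst emeasure_density) (auto simp: m_def intro!: nn_integral_cong split: split_indicator)
    also have "\<dots> = (if a < 0 then 0 else ennreal (unit_ball_vol (real m) * a ^ m))"
    proof (cases "a < 0")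
      case False
      have "(\<integral>\<^sup>+r. ennreal (unit_sphere_area m * r ^ (m - 1)) * indicator {0..a} r \<partial>lborel) =
          ennreal (unit_ball_vol (real m) * a ^ m - unit_ball_vol (real m) * 0 ^ m)"
        using False
        by (intro nn_integral_FTC_Icc) (auto intro!: derivative_eq_intros simp: unit_sphere_area_def)
      then show ?thesis using False m by simp
    qed simp
    finally show ?thesis .
  qed
  show "emeasure ?L X = emeasure ?R X" if X: "X \<in> ?E" for X
  proof -
    obtain a where "X = {..a}" using X by blast
    then show ?thesis by (simp only: L_eq R_eq)
  qed
  show "range (\<lambda>n::nat. {..real n}) \<subseteq> ?E" "(\<Union>n::nat. {..real n}) = UNIV"
    by (auto intro: real_arch_simple)
  show "emeasure ?L {..real n} \<noteq> \<infinity>" for n :: nat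
    by (simp add: L_eq)
qed

text \<open>The integrand is the derivative of \<open>\<kappa> (y\<^sup>2 + a)\<close>, so the
  fundamental theorem leaves the values at the two ends: \<open>\<kappa> a\<close> at 0 and 0 at
  infinity.\<close>

lemma integral_half_line_derivative:
  fixes \<kappa> \<kappa>' :: "real \<Rightarrow> real"
  assumes deriv: "\<And>r. r \<ge> 0 \<Longrightarrow> (\<kappa> has_real_derivative \<kappa>' r) (at r within {0..})"
    and cont: "continuous_on {0..} \<kappa>'"
    and lim: "(\<kappa> \<longlongrightarrow> 0) at_top" and "a \<ge> 0"
    and int: "integrable lborel (\<lambda>y. indicator {0<..} y * (2 * y * \<kappa>' (y\<^sup>2 + a)))"
  shows "(LINT y|lborel. indicator {0<..} y * (2 * y * \<kappa>' (y\<^sup>2 + a))) = - \<kappa> a"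
proof -
  let ?f = "\<lambda>y. 2 * y * \<kappa>' (y\<^sup>2 + a)" and ?F = "\<lambda>y. \<kappa> (y\<^sup>2 + a)"
  \<comment> \<open>On the open half line the one-sided derivative of \<kappa> is two-sided; the
    endpoint 0 enters through a limit.\<close>
  have at: "at r within {0..} = at r" if "r > 0" for r :: real
    using that by (intro at_within_interior) auto
  have pos: "x\<^sup>2 + a > 0" if "x > 0" for x
    using that \<open>a \<ge> 0\<close> by (intro add_pos_nonneg) auto
  have "(LBINT y=ereal 0..\<infinity>. ?f y) = 0 - \<kappa> a"
  proof (rule interval_integral_FTC_integrable)
    fix x assume "ereal 0 < ereal x"
    then have x: "x > 0" by simp
    have "(\<kappa> has_real_derivative \<kappa>' (x\<^sup>2 + a)) (at (x\<^sup>2 + a))"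
      using deriv[of "x\<^sup>2 + a"] at[OF pos[OF x]] pos[OF x] by simp
    then have "(?F has_real_derivative \<kappa>' (x\<^sup>2 + a) * (2 * x)) (at x)"
      by (rule DERIV_chain2[where g = "\<lambda>y. y\<^sup>2 + a" and x = x]) (auto intro!: derivative_eq_intros)
    then have "(?F has_real_derivative ?f x) (at x)"
      by (simp add: mult_ac)
    then show "(?F has_vector_derivative ?f x) (at x)"
      by (simp add: has_real_derivative_iff_has_vector_derivative)
    have "isCont \<kappa>' (x\<^sup>2 + a)"
      using cont by (rule continuous_on_interior) (use pos[OF x] in auto)
    then have "isCont (\<lambda>y. \<kappa>' (y\<^sup>2 + a)) x"
      by (rule isCont_o2[where f = "\<lambda>y. y\<^sup>2 + a" and g = \<kappa>', rotated]) (intro continuous_intros)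
    then show "isCont ?f x" by (intro continuous_intros)
  next
    show "set_integrable lborel (einterval (ereal 0) \<infinity>) ?f"
      using int by (simp add: set_integrable_def)
    have "continuous_on {0..} \<kappa>"
      using deriv by (auto intro!: DERIV_continuous simp: continuous_on_eq_continuous_within)
    then have "continuous_on UNIV ?F"
      by (rule continuous_on_compose2) (use \<open>a \<ge> 0\<close> in \<open>auto intro!: continuous_intros\<close>)
    then have "isCont ?F 0"
      by (rule continuous_on_interior) simp
    then have "continuous (at_right 0) ?F"
      by (rule continuous_at_imp_continuous_at_within)
    then show "((?F \<circ> real_of_ereal) \<longlongrightarrow> \<kappa> a) (at_right (ereal 0))"
      unfolding ereal_tendsto_simps continuous_within by simp
    have "filterlim (\<lambda>y::real. a + y\<^sup>2) at_top at_top"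
      by (intro filterlim_tendsto_add_at_top[OF tendsto_const] filterlim_pow_at_top filterlim_ident) simp
    then have "filterlim (\<lambda>y::real. y\<^sup>2 + a) at_top at_top"
      by (simp only: add.commute)
    then show "((?F \<circ> real_of_ereal) \<longlongrightarrow> 0) (at_left \<infinity>)"
      unfolding ereal_tendsto_simps by (rule filterlim_compose[OF lim])
  qed simp
  then show ?thesis
    by (simp add: interval_lebesgue_integral_def set_lebesgue_integral_def)
qed

text \<open>Fubini splits off the coordinate along \<open>b\<close>. Its half-line integral leaves
  \<open>- \<kappa>\<close> at the squared norm of the other coordinates, which polar coordinates in
  dimension \<open>DIM('a) - 1\<close> evaluate.\<close>

lemma integral_half_space_axis:
  fixes \<kappa> \<kappa>' :: "real \<Rightarrow> real" and b :: "'a::euclidean_space"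
  assumes deriv: "\<And>r. r \<ge> 0 \<Longrightarrow> (\<kappa> has_real_derivative \<kappa>' r) (at r within {0..})"
    and cont: "continuous_on {0..} \<kappa>'"
    and lim: "(\<kappa> \<longlongrightarrow> 0) at_top"
    and b: "b \<in> Basis" and dim: "DIM('a) \<ge> 2"
    and int: "integrable lborel (\<lambda>z::'a. indicator {z. z \<bullet> b > 0} z * (2 * (z \<bullet> b) * \<kappa>' ((norm z)\<^sup>2)))"
  shows "(LINT z|lborel. indicator {z. z \<bullet> b > 0} z * (2 * (z \<bullet> b) * \<kappa>' ((norm z)\<^sup>2))) =
    - (unit_sphere_area (DIM('a) - 1) * (LBINT r:{0..}. \<kappa> (r\<^sup>2) * r ^ (DIM('a) - 2)))"
proof -
  interpret product_sigma_finite "\<lambda>_::'a. lborel :: real measure"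
    by standard
  define B where "B = Basis - {b}"
  have B: "finite B" "b \<notin> B" "Basis = insert b B" "card B = DIM('a) - 1"
    using b by (auto simp: B_def)
  then have "B \<noteq> {}" using dim by auto
  have \<kappa>_cont: "continuous_on {0..} \<kappa>"
    using deriv by (auto intro!: DERIV_continuous simp: continuous_on_eq_continuous_within)
  have \<kappa>_meas: "(\<lambda>r. - \<kappa> (r\<^sup>2)) \<in> borel_measurable borel"
    by (intro borel_measurable_continuous_onI continuous_on_compose2[OF \<kappa>_cont] continuous_intros) auto
  let ?G = "\<lambda>z::'a. indicator {z. z \<bullet> b > 0} z * (2 * (z \<bullet> b) * \<kappa>' ((norm z)\<^sup>2))"
  define F where "F x = indicator {0<..} (x b) * (2 * x b * \<kappa>' ((x b)\<^sup>2 + (\<Sum>i\<in>B. (x i)\<^sup>2)))" for x :: "'a \<Rightarrow> real"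
  have GF: "?G (\<Sum>i\<in>Basis. x i *\<^sub>R i) = F x" for x
  proof -
    have "(norm (\<Sum>i\<in>Basis. x i *\<^sub>R i :: 'a))\<^sup>2 = (\<Sum>i\<in>Basis. (x i)\<^sup>2)"
      unfolding power2_norm_eq_inner by (subst euclidean_inner) (simp add: power2_eq_square)
    also have "\<dots> = (x b)\<^sup>2 + (\<Sum>i\<in>B. (x i)\<^sup>2)"
      unfolding B(3) using B(1,2) by simp
    finally show ?thesis using b by (simp add: F_def indicator_def)
  qed
  have [measurable]: "?G \<in> borel_measurable borel"
    using borel_measurable_integrable[OF int] by simp
  have F_int: "integrable (Pi\<^sub>M (insert b B) (\<lambda>_. lborel)) F"
    using int unfolding lborel_eq[where 'a = 'a] B(3)[symmetric]
    by (subst (asm) integrable_distr_eq) (simp_all add: GF)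
  then have F_meas[measurable]: "F \<in> borel_measurable (Pi\<^sub>M (insert b B) (\<lambda>_. lborel))"
    by (rule borel_measurable_integrable)
  let ?P = "Pi\<^sub>M B (\<lambda>_. lborel :: real measure)"
  have n_meas: "(\<lambda>x. sqrt (\<Sum>i\<in>B. (x i)\<^sup>2)) \<in> borel_measurable ?P"
    by measurable
  have upd: "F (x(b := y)) = indicator {0<..} y * (2 * y * \<kappa>' (y\<^sup>2 + (\<Sum>i\<in>B. (x i)\<^sup>2)))" for x y
  proof -
    have "(\<Sum>i\<in>B. ((x(b := y)) i)\<^sup>2) = (\<Sum>i\<in>B. (x i)\<^sup>2)"
      using B(2) by (intro sum.cong) auto
    then show ?thesis by (simp add: F_def)
  qed
  have upd_meas[measurable]: "(\<lambda>(x, y). F (x(b := y))) \<in> borel_measurable (?P \<Otimes>\<^sub>M lborel)"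
    by measurable
  \<comment> \<open>Tonelli makes almost every slice integrable, as the half-line formula
    requires.\<close>
  have "(\<integral>\<^sup>+x. (\<integral>\<^sup>+y. ennreal (norm (F (x(b := y)))) \<partial>lborel) \<partial>?P) < \<infinity>"
    using F_int product_nn_integral_insert[OF B(1,2), of "\<lambda>x. ennreal (norm (F x))"]
    by (simp add: integrable_iff_bounded)
  then have "AE x in ?P. (\<integral>\<^sup>+y. ennreal (norm (F (x(b := y)))) \<partial>lborel) \<noteq> \<infinity>"
    by (intro nn_integral_PInf_AE) auto
  then have inner: "AE x in ?P. (LINT y|lborel. F (x(b := y))) = - \<kappa> (\<Sum>i\<in>B. (x i)\<^sup>2)"
    using AE_space
  proof eventually_elim
    case (elim x)
    have "integrable lborel (\<lambda>y. F (x(b := y)))"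
      unfolding integrable_iff_bounded
    proof
      show "(\<lambda>y. F (x(b := y))) \<in> borel_measurable lborel"
        using measurable_Pair2[OF upd_meas elim(2)] by simp
    qed (use elim(1) in \<open>simp add: less_top\<close>)
    then show ?case
      unfolding upd by (intro integral_half_line_derivative[OF deriv cont lim]) (auto simp: sum_nonneg)
  qed
  have "(LINT z|lborel. ?G z) = (LINT x|Pi\<^sub>M (insert b B) (\<lambda>_. lborel). F x)"
    unfolding lborel_eq[where 'a = 'a] B(3)[symmetric] by (subst integral_distr) (simp_all add: GF)
  also have "\<dots> = (LINT x|?P. (LINT y|lborel. F (x(b := y))))"
    by (rule product_integral_insert[OF B(1,2) F_int])
  \<comment> \<open>The squared square root displays the integrand as a function of the norm, ready
    for the image measure.\<close>
  also have "\<dots> = (LINT x|?P. - \<kappa> ((sqrt (\<Sum>i\<in>B. (x i)\<^sup>2))\<^sup>2))"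
  proof (rule integral_cong_AE)
    show "AE x in ?P. (LINT y|lborel. F (x(b := y))) = - \<kappa> ((sqrt (\<Sum>i\<in>B. (x i)\<^sup>2))\<^sup>2)"
      using inner by (simp add: sum_nonneg)
    show "(\<lambda>x. LINT y|lborel. F (x(b := y))) \<in> borel_measurable ?P"
      by measurable
    show "(\<lambda>x. - \<kappa> ((sqrt (\<Sum>i\<in>B. (x i)\<^sup>2))\<^sup>2)) \<in> borel_measurable ?P"
      by (rule measurable_compose[OF n_meas \<kappa>_meas])
  qed
  also have "\<dots> = (LINT r|distr ?P borel (\<lambda>x. sqrt (\<Sum>i\<in>B. (x i)\<^sup>2)). - \<kappa> (r\<^sup>2))"
    by (rule integral_distr[OF n_meas \<kappa>_meas, symmetric])
  also have "\<dots> = (LINT r|lborel. (indicator {0..} r * (unit_sphere_area (card B) * r ^ (card B - 1))) *\<^sub>R - \<kappa> (r\<^sup>2))"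
    unfolding distr_PiM_lborel_norm[OF B(1) \<open>B \<noteq> {}\<close>]
    using \<kappa>_meas by (intro integral_density) (auto simp: unit_sphere_area_def split: split_indicator)
  also have "\<dots> = (LINT r|lborel. - unit_sphere_area (card B) * (indicator {0..} r *\<^sub>R (\<kappa> (r\<^sup>2) * r ^ (DIM('a) - 2))))"
    by (intro Bochner_Integration.integral_cong) (auto simp: B(4) numeral_2_eq_2)
  also have "\<dots> = - (unit_sphere_area (DIM('a) - 1) * (LBINT r:{0..}. \<kappa> (r\<^sup>2) * r ^ (DIM('a) - 2)))"
    by (simp add: set_lebesgue_integral_def B(4))
  finally show ?thesis .
qed

text \<open>The vector integral \<open>V\<close> commutes with orthogonal maps, which reduces the
  claim to a coordinate direction \<open>e\<close>. There the axis formula gives the component along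
  \<open>e\<close>, and reflections cancel all others.\<close>

lemma integral_half_space_radial:
  fixes \<kappa> \<kappa>' :: "real \<Rightarrow> real" and \<nu> :: "real ^ 'n::finite"
  assumes deriv: "\<And>r. r \<ge> 0 \<Longrightarrow> (\<kappa> has_real_derivative \<kappa>' r) (at r within {0..})"
    and cont: "continuous_on {0..} \<kappa>'"
    and lim: "(\<kappa> \<longlongrightarrow> 0) at_top"
    and dim: "CARD('n) \<ge> 2"
    and int: "integrable lborel (\<lambda>z::real ^ 'n. (2 * \<kappa>' ((norm z)\<^sup>2)) *\<^sub>R z)"
    and \<nu>: "norm \<nu> = 1"
  shows "(LINT z|lborel. indicator {z. z \<bullet> \<nu> > 0} z *\<^sub>R ((2 * \<kappa>' ((norm z)\<^sup>2)) *\<^sub>R z)) =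
    - ((unit_sphere_area (CARD('n) - 1) * (LBINT r:{0..}. \<kappa> (r\<^sup>2) * r ^ (CARD('n) - 2))) *\<^sub>R \<nu>)"
proof -
  let ?\<Psi> = "\<lambda>z::real ^ 'n. (2 * \<kappa>' ((norm z)\<^sup>2)) *\<^sub>R z"
  define \<xi> where "\<xi> = unit_sphere_area (CARD('n) - 1) * (LBINT r:{0..}. \<kappa> (r\<^sup>2) * r ^ (CARD('n) - 2))"
  define V where "V \<mu> = (LINT z|lborel. indicator {z. z \<bullet> \<mu> > 0} z *\<^sub>R ?\<Psi> z)" for \<mu>
  have [measurable]: "?\<Psi> \<in> borel_measurable borel"
    using borel_measurable_integrable[OF int] by simp
  have V_int: "integrable lborel (\<lambda>z. indicator {z. z \<bullet> \<mu> > 0} z *\<^sub>R ?\<Psi> z)" for \<mu>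
    using int by (intro integrable_mult_indicator) auto
  have V_T: "V (T \<mu>) = T (V \<mu>)" if T: "orthogonal_transformation T" for T \<mu>
  proof -
    have bl: "bounded_linear T"
      using orthogonal_transformation_linear[OF T] by (simp add: linear_conv_bounded_linear)
    have "V (T \<mu>) = (LINT z|lborel. indicator {z. z \<bullet> T \<mu> > 0} (T z) *\<^sub>R ?\<Psi> (T z))"
      unfolding V_def by (rule integral_lborel_orthogonal[OF T, symmetric]) measurable
    also have "\<dots> = (LINT z|lborel. T (indicator {z. z \<bullet> \<mu> > 0} z *\<^sub>R ?\<Psi> z))"
    proof (rule Bochner_Integration.integral_cong)
      fix z
      have "T z \<bullet> T \<mu> = z \<bullet> \<mu>" using T by (simp add: orthogonal_transformation_def)
      then show "indicator {z. z \<bullet> T \<mu> > 0} (T z) *\<^sub>R ?\<Psi> (T z) = T (indicator {z. z \<bullet> \<mu> > 0} z *\<^sub>R ?\<Psi> z)"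
        by (simp add: indicator_def orthogonal_transformation_norm[OF T] linear_simps(5)[OF bl] linear_simps(3)[OF bl])
    qed simp
    also have "\<dots> = T (V \<mu>)"
      unfolding V_def by (rule integral_bounded_linear[OF bl V_int])
    finally show ?thesis .
  qed
  obtain e :: "real ^ 'n" where "e \<in> Basis"
    using nonempty_Basis by blast
  then have e: "e \<in> Basis" "norm e = 1" by simp_all
  have V_inner: "V e \<bullet> b = (LINT z|lborel. indicator {z. z \<bullet> e > 0} z * (2 * (z \<bullet> b) * \<kappa>' ((norm z)\<^sup>2)))" for b
    unfolding V_def using integral_inner_left[OF V_int[of e], of b]
    by (simp add: mult_ac)
  have Ve: "V e \<bullet> e = - \<xi>"
    unfolding V_inner \<xi>_def
  proof (subst integral_half_space_axis[OF deriv cont lim e(1)])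
    show "integrable lborel (\<lambda>z. indicator {z. z \<bullet> e > 0} z * (2 * (z \<bullet> e) * \<kappa>' ((norm z)\<^sup>2)))"
      using integrable_inner_left[OF V_int[of e], of e] by (simp add: mult_ac)
  qed (use dim in auto)
  have Vb: "V e \<bullet> b = 0" if b: "b \<in> Basis" "b \<noteq> e" for b
  proof -
    \<comment> \<open>This reflection fixes \<open>e\<close>, hence also \<open>V e\<close>, but
      reverses the component along \<open>b\<close>, which must then be 0.\<close>
    define T where "T x = x - (2 * (x \<bullet> b)) *\<^sub>R b" for x
    have "orthogonal_transformation T"
      unfolding orthogonal_transformation_def linear_iff T_def using b(1)
      by (auto simp: algebra_simps inner_diff_left inner_diff_right inner_add_left inner_commute)
    moreover have "T e = e"
      using b e(1) by (simp add: T_def inner_Basis)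
    ultimately have "V e = T (V e)" using V_T[of T e] by simp
    then have "V e \<bullet> b = T (V e) \<bullet> b" by (rule arg_cong)
    moreover have "T (V e) \<bullet> b = V e \<bullet> b - 2 * (V e \<bullet> b)"
      using b(1) by (simp add: T_def inner_diff_left)
    ultimately show ?thesis by linarith
  qed
  have "V e = - (\<xi> *\<^sub>R e)"
  proof (rule euclidean_eqI)
    fix b :: "real ^ 'n" assume b: "b \<in> Basis"
    show "V e \<bullet> b = - (\<xi> *\<^sub>R e) \<bullet> b"
      using Ve Vb[OF b] e(1) b by (cases "b = e") (simp_all add: inner_not_same_Basis)
  qed
  moreover obtain T where T: "orthogonal_transformation T" "T e = \<nu>"
    using orthogonal_transformation_exists_1[OF e(2) \<nu>] by blast
  ultimately have "V \<nu> = - (\<xi> *\<^sub>R \<nu>)"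
    using V_T[OF T(1), of e] orthogonal_transformation_linear[OF T(1)]
    by (simp add: linear_neg linear_scale)
  then show ?thesis by (simp add: V_def \<xi>_def)
qed

text \<open>Uniform in \<open>\<nu>\<close>: by rotation invariance the integral does not depend on \<open>\<nu>\<close>, and for fixed
  \<open>\<nu>\<close> the sets shrink to a hyperplane.\<close>

lemma small_integral_slab:
  fixes g :: "real ^ 'n::finite \<Rightarrow> real"
  assumes int: "integrable lborel g"
    and inv: "\<And>T z. orthogonal_transformation T \<Longrightarrow> g (T z) = g z"
    and "\<eta> > 0"
  obtains i :: nat where "\<And>\<nu>. norm \<nu> = 1 \<Longrightarrow>
    (LINT z|lborel. indicator {z. norm z > real i \<or> \<bar>z \<bullet> \<nu>\<bar> < 1 / (real i + 1)} z * g z) < \<eta>"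
proof -
  have [measurable]: "g \<in> borel_measurable borel"
    using borel_measurable_integrable[OF int] by simp
  \<comment> \<open>One index \<open>i\<close> sends the radius to infinity and the slab width to 0
    together; \<open>real i + 1\<close> avoids division by zero.\<close>
  let ?S = "\<lambda>(i::nat) \<nu>. {z::real ^ 'n. norm z > real i \<or> \<bar>z \<bullet> \<nu>\<bar> < 1 / (real i + 1)}"
  obtain e :: "real ^ 'n" where "e \<in> Basis"
    using nonempty_Basis by blast
  then have e: "norm e = 1" by simp
  have "{z. e \<bullet> z = 0} \<in> null_sets lborel"
  proof -
    have "negligible {z. e \<bullet> z = 0}"
      using e by (intro negligible_hyperplane) auto
    then show ?thesis
      by (subst null_sets_completion_iff[symmetric]) (auto simp: negligible_iff_null_sets intro: closed_hyperplane)
  qed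
  then have ne: "AE z in lborel. e \<bullet> z \<noteq> 0"
    by (rule AE_I'[where N = "{z. e \<bullet> z = 0}"]) auto
  have "(\<lambda>i. LINT z|lborel. indicator (?S i e) z * g z) \<longlonglongrightarrow> (LINT z::real ^ 'n|lborel. 0)"
  proof (rule integral_dominated_convergence[where w = "\<lambda>z. \<bar>g z\<bar>"])
    show "AE z in lborel. (\<lambda>i. indicator (?S i e) z * g z) \<longlonglongrightarrow> 0"
      using ne
    proof eventually_elim
      case (elim z)
      \<comment> \<open>Each point off the hyperplane eventually leaves the sets, so the integrand
        there is eventually 0.\<close>
      have "\<forall>\<^sub>F i in sequentially. real i \<ge> norm z"
        using filterlim_real_sequentially by (simp add: filterlim_at_top)
      moreover have "(\<lambda>i. 1 / (real i + 1)) \<longlonglongrightarrow> 0"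
        using LIMSEQ_inverse_real_of_nat by (simp add: inverse_eq_divide add.commute)
      then have "\<forall>\<^sub>F i in sequentially. 1 / (real i + 1) < \<bar>z \<bullet> e\<bar>"
        using elim by (intro order_tendstoD) (auto simp: inner_commute)
      ultimately have "\<forall>\<^sub>F i in sequentially. indicator (?S i e) z * g z = 0"
        by eventually_elim (auto simp: indicator_def)
      then show ?case by (rule tendsto_eventually)
    qed
    show "AE z in lborel. norm (indicator (?S i e) z * g z) \<le> \<bar>g z\<bar>" for i
      by (auto simp: indicator_def)
  qed (use int in auto)
  then have "(\<lambda>i. LINT z|lborel. indicator (?S i e) z * g z) \<longlonglongrightarrow> 0" by simp
  then have "\<forall>\<^sub>F i in sequentially. (LINT z|lborel. indicator (?S i e) z * g z) < \<eta>"
    using \<open>\<eta> > 0\<close> by (rule order_tendstoD)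
  then obtain i where i: "(LINT z|lborel. indicator (?S i e) z * g z) < \<eta>"
    using eventually_happens[of _ sequentially] by auto
  show thesis
  proof
    fix \<nu> :: "real ^ 'n" assume "norm \<nu> = 1"
    then obtain T where T: "orthogonal_transformation T" "T e = \<nu>"
      using orthogonal_transformation_exists_1[OF e] by blast
    have "(LINT z|lborel. indicator (?S i \<nu>) z * g z) = (LINT z|lborel. indicator (?S i \<nu>) (T z) * g (T z))"
      by (rule integral_lborel_orthogonal[OF T(1), symmetric]) measurable
    also have "\<dots> = (LINT z|lborel. indicator (?S i e) z * g z)"
    proof (rule Bochner_Integration.integral_cong)
      fix z
      have "T z \<bullet> \<nu> = z \<bullet> e"
        using T by (auto simp: orthogonal_transformation_def)
      then show "indicator (?S i \<nu>) (T z) * g (T z) = indicator (?S i e) z * g z"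
        by (simp add: inv[OF T(1)] orthogonal_transformation_norm[OF T(1)] indicator_def)
    qed simp
    finally show "(LINT z|lborel. indicator (?S i \<nu>) z * g z) < \<eta>" using i by simp
  qed
qed

subsection \<open>Asymptotics of the gradient\<close>

theorem theorem3:
  fixes A :: "(real ^ 'n::finite) set"
    and \<kappa> \<kappa>' :: "real \<Rightarrow> real"
    and \<alpha> \<xi> :: real
    and p :: "real ^ 'n"
    and n :: "real ^ 'n \<Rightarrow> real ^ 'n"
  assumes N: "CARD('n) \<ge> 2"
    and A: "open A"
    and \<kappa>_deriv: "\<And>r. r \<ge> 0 \<Longrightarrow> (\<kappa> has_real_derivative \<kappa>' r) (at r within {0..})"
    and \<kappa>'_cont: "continuous_on {0..} \<kappa>'"
    and \<kappa>1_lim: "(\<kappa> \<longlongrightarrow> 0) at_top"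
    and \<kappa>1_int: "(\<integral>\<^sup>+ x. ennreal \<bar>\<kappa> ((norm (x :: real ^ 'n))\<^sup>2)\<bar> \<partial>lborel) < \<infinity>"
    and \<kappa>2_lim: "((\<lambda>r. r * \<kappa>' (r\<^sup>2)) \<longlongrightarrow> 0) at_top"
    and \<kappa>2_int: "\<And>K :: (real ^ 'n) set. compact K \<Longrightarrow>
      (\<integral>\<^sup>+ x. (SUP b\<in>K. ennreal (norm (x + b) * \<bar>\<kappa>' ((norm (x + b))\<^sup>2)\<bar>)) \<partial>lborel) < \<infinity>"
    and \<alpha>: "0 < \<alpha>" "\<alpha> \<le> 1"
    and p: "p \<in> frontier A"
    and surface: "C1_Holder_surface_at \<alpha> A p"
    and normal: "\<forall>\<^sub>F x in nhds p. x \<in> frontier A \<longrightarrow> outward_unit_normal_at A x (n x)"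
    and \<xi>: "\<xi> = unit_sphere_area (CARD('n) - 1) * (LBINT r:{0..}. \<kappa> (r\<^sup>2) * r ^ (CARD('n) - 2))"
  shows "\<exists>U R. open U \<and> p \<in> U \<and>
    (\<forall>t>0. \<forall>x\<in>frontier A \<inter> U.
       GDERIV (kernel_integral A \<kappa> t) x :> - (t powr (- 1 / 2)) *\<^sub>R (\<xi> *\<^sub>R n x + R t x)) \<and>
    uniform_limit (frontier A \<inter> U) R (\<lambda>x. 0) (at_right 0)"
proof -
  let ?\<Psi> = "\<lambda>z::real ^ 'n. (2 * \<kappa>' ((norm z)\<^sup>2)) *\<^sub>R z"
  have \<kappa>_cont: "continuous_on {0..} \<kappa>"
    using \<kappa>_deriv by (auto intro!: DERIV_continuous simp: continuous_on_eq_continuous_within)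
  have \<kappa>_int: "integrable lborel (\<lambda>x::real ^ 'n. \<kappa> ((norm x)\<^sup>2))"
    unfolding integrable_iff_bounded
  proof
    have "continuous_on UNIV (\<lambda>x::real ^ 'n. \<kappa> ((norm x)\<^sup>2))"
      by (intro continuous_on_compose2[OF \<kappa>_cont] continuous_intros) auto
    then show "(\<lambda>x::real ^ 'n. \<kappa> ((norm x)\<^sup>2)) \<in> borel_measurable lborel"
      using borel_measurable_continuous_onI by simp
  qed (use \<kappa>1_int in simp)
  have \<Psi>_int: "integrable lborel ?\<Psi>"
    unfolding integrable_iff_bounded
  proof
    have "continuous_on UNIV ?\<Psi>"
      by (intro continuous_intros continuous_on_compose2[OF \<kappa>'_cont]) auto
    then show \<Psi>_meas: "?\<Psi> \<in> borel_measurable lborel"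
      using borel_measurable_continuous_onI by simp
    let ?D = "\<lambda>z::real ^ 'n. ennreal (norm z * \<bar>\<kappa>' ((norm z)\<^sup>2)\<bar>)"
    have "continuous_on UNIV (\<lambda>z::real ^ 'n. norm z * \<bar>\<kappa>' ((norm z)\<^sup>2)\<bar>)"
      by (intro continuous_intros continuous_on_compose2[OF \<kappa>'_cont]) auto
    then have [measurable]: "(\<lambda>z::real ^ 'n. norm z * \<bar>\<kappa>' ((norm z)\<^sup>2)\<bar>) \<in> borel_measurable borel"
      by (rule borel_measurable_continuous_onI)
    have "(\<integral>\<^sup>+z. ennreal (norm (?\<Psi> z)) \<partial>lborel) = (\<integral>\<^sup>+z. 2 * ?D z \<partial>lborel)"
      by (intro nn_integral_cong) (simp add: abs_mult ennreal_mult' mult_ac)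
    also have "\<dots> = 2 * (\<integral>\<^sup>+z. ?D z \<partial>lborel)"
      by (intro nn_integral_cmult) simp
    also have "\<dots> < \<infinity>"
      \<comment> \<open>For the singleton \<open>{0}\<close> the supremum collapses, and (\<kappa>2)
        becomes integrability of the gradient kernel.\<close>
      using \<kappa>2_int[of "{0}"] by (simp add: ennreal_mult_less_top)
    finally show "(\<integral>\<^sup>+z. ennreal (norm (?\<Psi> z)) \<partial>lborel) < \<infinity>" .
  qed
  then have [measurable]: "?\<Psi> \<in> borel_measurable borel"
    using borel_measurable_integrable by fastforce
  obtain U0 f g where U0: "open U0" "p \<in> U0"
    and fg: "\<And>y. y \<in> U0 \<Longrightarrow> GDERIV f y :> g y" and g_cont: "continuous_on U0 g"
    and g_nz: "\<And>y. y \<in> U0 \<Longrightarrow> g y \<noteq> 0"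
    and fA: "\<And>y. y \<in> U0 \<Longrightarrow> y \<in> A \<longleftrightarrow> f y > 0"
    and fF: "\<And>y. y \<in> U0 \<Longrightarrow> y \<in> frontier A \<longleftrightarrow> f y = 0"
    and tangent: "\<And>y v. y \<in> U0 \<Longrightarrow> y \<in> frontier A \<Longrightarrow> g y \<bullet> v = 0 \<Longrightarrow> tangent_vector_at (frontier A) y v"
    using C1_Holder_surface_at_defining_function[OF surface \<alpha>(1) A] by blast
  obtain U1 where U1: "open U1" "p \<in> U1"
    and normal1: "\<And>x. x \<in> U1 \<Longrightarrow> x \<in> frontier A \<Longrightarrow> outward_unit_normal_at A x (n x)"
    using normal unfolding eventually_nhds by blast
  have n_eq: "n x = - sgn (g x)" if "x \<in> U0" "x \<in> U1" "x \<in> frontier A" for x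
    using normal1[OF that(2,3)] U0(1) that(1) fg[OF that(1)] fF[OF that(1)] that(3) fA
      tangent[OF that(1,3)] g_nz[OF that(1)]
    by (intro outward_unit_normal_at_eq[of A x "n x" U0 f]) auto
  obtain r where r: "r > 0" "ball p r \<subseteq> U0 \<inter> U1"
    and cone: "\<And>\<epsilon>. \<epsilon> > 0 \<Longrightarrow> \<exists>\<delta>>0. \<forall>x\<in>ball p r. \<forall>w. f x = 0 \<longrightarrow> w \<noteq> 0 \<longrightarrow> norm w < \<delta> \<longrightarrow>
       x - w \<in> U0 \<inter> U1 \<and> (w \<bullet> sgn (g x) \<le> - \<epsilon> * norm w \<longrightarrow> f (x - w) > 0) \<and>
       (w \<bullet> sgn (g x) \<ge> \<epsilon> * norm w \<longrightarrow> f (x - w) < 0)"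
  proof (rule level_set_cone_condition[of "U0 \<inter> U1" p f g])
    show "continuous_on (U0 \<inter> U1) g" using g_cont by (rule continuous_on_subset) auto
  qed (use U0 U1 fg g_nz in auto)
  define W where "W t x = (LINT z|lborel. indicator {z. x - sqrt t *\<^sub>R z \<in> A} z *\<^sub>R ?\<Psi> z)" for t x
  have [measurable]: "A \<in> sets borel" using A by simp
  \<comment> \<open>\<open>R\<close> is the exact remainder: the gradient formula holds by
    construction, and its uniform decay is what has to be shown.\<close>
  define R where "R t x = - W t x - \<xi> *\<^sub>R n x" for t x
  have "GDERIV (kernel_integral A \<kappa> t) x :> - (t powr (- 1 / 2)) *\<^sub>R (\<xi> *\<^sub>R n x + R t x)" if "t > 0" for t x
    using GDERIV_kernel_integral[OF _ \<kappa>_deriv \<kappa>'_cont \<kappa>_int \<kappa>2_int[OF compact_cball] that, of A x]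
    by (simp add: R_def W_def)
  moreover have "uniform_limit (frontier A \<inter> ball p r) R (\<lambda>x. 0) (at_right 0)"
    unfolding uniform_limit_iff
  proof (intro allI impI)
    fix \<eta> :: real assume "\<eta> > 0"
    have \<Psi>_T: "norm (?\<Psi> (T z)) = norm (?\<Psi> z)" if "orthogonal_transformation T" for T z
      by (simp add: orthogonal_transformation_norm[OF that])
    obtain i :: nat where i: "\<And>\<nu>. norm \<nu> = 1 \<Longrightarrow>
      (LINT z|lborel. indicator {z. norm z > real i \<or> \<bar>z \<bullet> \<nu>\<bar> < 1 / (real i + 1)} z * norm (?\<Psi> z)) < \<eta>"
    proof (rule small_integral_slab[where g = "\<lambda>z. norm (?\<Psi> z)" and \<eta> = \<eta>])
      show "integrable lborel (\<lambda>z. norm (?\<Psi> z))" using \<Psi>_int by (rule integrable_norm)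
      show "norm (?\<Psi> (T z)) = norm (?\<Psi> z)" if "orthogonal_transformation T" for T z
        using that by (rule \<Psi>_T)
      show "\<eta> > 0" by fact
    qed blast
    define I where "I = real i + 1"
    have I: "I > 0" by (simp add: I_def)
    \<comment> \<open>If \<open>norm z \<le> I\<close> and
      \<open>\<bar>z \<bullet> n x\<bar> \<ge> 1 / I\<close>, then
      \<open>\<bar>z \<bullet> n x\<bar>\<close> is at least \<open>1 / I\<^sup>2\<close> times
      \<open>norm z\<close>, hence this aperture of the cone.\<close>
    obtain \<delta> where \<delta>: "\<delta> > 0" and cone_\<delta>: "\<And>x w. x \<in> ball p r \<Longrightarrow> f x = 0 \<Longrightarrow> w \<noteq> 0 \<Longrightarrow> norm w < \<delta> \<Longrightarrow>
       x - w \<in> U0 \<inter> U1 \<and> (w \<bullet> sgn (g x) \<le> - (1 / I\<^sup>2) * norm w \<longrightarrow> f (x - w) > 0) \<and>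
       (w \<bullet> sgn (g x) \<ge> 1 / I\<^sup>2 * norm w \<longrightarrow> f (x - w) < 0)"
      using cone[of "1 / I\<^sup>2"] I by (auto simp: I_def)
    \<comment> \<open>The threshold on \<open>t\<close> gives \<open>sqrt t * I < \<delta>\<close>,
      so scaled vectors \<open>sqrt t *\<^sub>R z\<close> with \<open>norm z \<le> I\<close> are
      within reach of the cone condition, whatever \<open>x\<close> is.\<close>
    have "dist (R t x) 0 < \<eta>" if t: "0 < t" "t < (\<delta> / I)\<^sup>2" and x: "x \<in> frontier A \<inter> ball p r" for t x
    proof -
      define s where "s = sqrt t"
      have s: "s > 0" "s * I < \<delta>"
      proof -
        have "s < \<delta> / I"
          using real_sqrt_less_mono[OF t(2)] \<delta> I by (simp add: s_def)
        then show "s * I < \<delta>" using I by (simp add: pos_less_divide_eq)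
      qed (use t in \<open>simp add: s_def\<close>)
      have xU: "x \<in> U0" "x \<in> U1" using x r(2) by auto
      have nx: "n x = - sgn (g x)" using n_eq[OF xU] x by simp
      then have nx1: "norm (n x) = 1" using g_nz[OF xU(1)] by (simp add: norm_sgn)
      let ?H = "{z. z \<bullet> n x > 0}" and ?A = "{z. x - sqrt t *\<^sub>R z \<in> A}"
      let ?S = "{z. norm z > real i \<or> \<bar>z \<bullet> n x\<bar> < 1 / (real i + 1)}"
      have agree: "z \<in> ?H \<longleftrightarrow> z \<in> ?A" if "z \<notin> ?S" for z
      proof -
        have z: "norm z \<le> real i" "\<bar>z \<bullet> n x\<bar> \<ge> 1 / I"
          using that by (auto simp: I_def)
        define w where "w = s *\<^sub>R z"
        have "z \<noteq> 0" using z(2) I by auto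
        then have "w \<noteq> 0" using s by (simp add: w_def)
        have nz: "norm z \<le> I" using z(1) by (simp add: I_def)
        have "norm w \<le> s * I" using mult_left_mono[OF nz, of s] s by (simp add: w_def)
        then have "norm w < \<delta>" using s by simp
        have "1 / I\<^sup>2 * norm w \<le> s * (1 / I)"
          using \<open>norm w \<le> s * I\<close> I by (simp add: field_simps power2_eq_square)
        also have "\<dots> \<le> s * \<bar>z \<bullet> n x\<bar>"
          using z(2) s by (intro mult_left_mono) auto
        finally have *: "1 / I\<^sup>2 * norm w \<le> \<bar>w \<bullet> sgn (g x)\<bar>"
          using s by (simp add: w_def nx abs_mult)
        \<comment> \<open>The outward normal is opposite to the gradient, so a positive
          \<open>z \<bullet> n x\<close> makes this product negative and puts \<open>x - w\<close>
          into \<open>A\<close>.\<close>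
        have wz: "w \<bullet> sgn (g x) = - (s * (z \<bullet> n x))"
          by (simp add: w_def nx)
        have fx: "f x = 0" using fF[OF xU(1)] x by simp
        note c = cone_\<delta>[OF _ fx \<open>w \<noteq> 0\<close> \<open>norm w < \<delta>\<close>]
        have cU: "x - w \<in> U0" using c x by auto
        show ?thesis
        proof (cases "z \<bullet> n x > 0")
          case True
          then have "s * (z \<bullet> n x) > 0" using s by simp
          then have "f (x - w) > 0" using c x * wz by auto
          then show ?thesis using True fA[OF cU] by (simp add: w_def s_def)
        next
          case False
          then have "s * (z \<bullet> n x) \<le> 0" using s by (simp add: mult_le_0_iff)
          then have "f (x - w) < 0" using c x * wz by auto
          then show ?thesis using False fA[OF cU] by (simp add: w_def s_def)
        qed
      qed
      have sets: "?H \<in> sets borel" "?A \<in> sets borel" "?S \<in> sets borel"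
        by measurable
      have ints: "integrable lborel (\<lambda>z. indicator ?H z *\<^sub>R ?\<Psi> z)" "integrable lborel (\<lambda>z. indicator ?A z *\<^sub>R ?\<Psi> z)"
        by (rule integrable_mult_indicator[OF _ \<Psi>_int]; simp add: sets)+
      \<comment> \<open>This turns the remainder into a difference of integrals of one kernel over
        two sets.\<close>
      have "(LINT z|lborel. indicator ?H z *\<^sub>R ?\<Psi> z) = - (\<xi> *\<^sub>R n x)"
        unfolding \<xi> by (rule integral_half_space_radial[OF \<kappa>_deriv \<kappa>'_cont \<kappa>1_lim N \<Psi>_int nx1])
      then have "R t x = (LINT z|lborel. indicator ?H z *\<^sub>R ?\<Psi> z) - W t x"
        by (simp only: R_def diff_conv_add_uminus add.commute)
      also have "\<dots> = (LINT z|lborel. indicator ?H z *\<^sub>R ?\<Psi> z - indicator ?A z *\<^sub>R ?\<Psi> z)"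
        unfolding W_def by (rule Bochner_Integration.integral_diff[OF ints, symmetric])
      finally have "norm (R t x) = norm (LINT z|lborel. indicator ?H z *\<^sub>R ?\<Psi> z - indicator ?A z *\<^sub>R ?\<Psi> z)"
        by (rule arg_cong)
      \<comment> \<open>The two indicators agree outside \<open>?S\<close> and differ by at most 1
        on it.\<close>
      also have "\<dots> \<le> (LINT z|lborel. indicator ?S z * norm (?\<Psi> z))"
      proof (rule Bochner_Integration.integral_norm_bound_integral)
        show "integrable lborel (\<lambda>z. indicator ?H z *\<^sub>R ?\<Psi> z - indicator ?A z *\<^sub>R ?\<Psi> z)"
          using ints by (rule Bochner_Integration.integrable_diff)
        show "integrable lborel (\<lambda>z. indicator ?S z * norm (?\<Psi> z))"
          using integrable_mult_indicator[OF _ integrable_norm[OF \<Psi>_int], of ?S] sets(3)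
          by (simp only: sets_lborel real_scaleR_def)
        fix z :: "real ^ 'n"
        show "norm (indicator ?H z *\<^sub>R ?\<Psi> z - indicator ?A z *\<^sub>R ?\<Psi> z) \<le> indicator ?S z * norm (?\<Psi> z)"
        proof (cases "z \<in> ?S")
          case False
          then have "(indicator ?H z :: real) = indicator ?A z"
            using agree[OF False] by (simp only: indicator_def)
          then show ?thesis by simp
        next
          case True
          then have "indicator ?S z = (1::real)" by (rule indicator_simps(1))
          then show ?thesis
            by (simp only: mult_1) (simp add: indicator_def)
        qed
      qed
      also have "\<dots> < \<eta>" by (rule i[OF nx1])
      finally show ?thesis by simp
    qed
    moreover have "(\<delta> / I)\<^sup>2 > 0" using \<delta> I by simp
    ultimately show "\<forall>\<^sub>F t in at_right 0. \<forall>x\<in>frontier A \<inter> ball p r. dist (R t x) 0 < \<eta>"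
      unfolding eventually_at_right_field by blast
  qed
  ultimately show ?thesis
    using r(1) by (intro exI[of _ "ball p r"] exI[of _ R]) auto
qed

end
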